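(* Consider the equation $$u_su_{zt}-u_zu_{st}-u_su_{xy}+u_yu_{sx}-u_yu_{rz}+u_zu_{ry}=0$$ for a scalar function $u$ of the six independent variables $x,y,z,r,s,t$ (where $u_s\neq0$). Then the relations $$\tilde U_y=\frac{u_y}{u_s}\tilde U_s-\frac{u_y}{u_s}U_r+U_t-\frac{u_{st}-u_{ry}}{u_s}U,$$ $$\tilde U_z=\frac{u_z}{u_s}\tilde U_s-\frac{u_z}{u_s}U_r+U_x+\frac{u_{rz}-u_{sx}}{u_s}U$$ define a recursion operator for this equation: whenever $U$ is a (possibly nonlocal) symmetry of the equation, so is $\tilde U$ defined by these relations.
   Context: Subscripts $x,y,z,r,s,t$ denote partial (total) derivatives. A (possibly nonlocal) symmetry of the equation is a solution $U$ of its linearization $$u_sU_{zt}+u_{zt}U_s-u_zU_{st}-u_{st}U_z-u_sU_{xy}-u_{xy}U_s+u_yU_{sx}+u_{sx}U_y-u_yU_{rz}-u_{rz}U_y+u_zU_{ry}+u_{ry}U_z=0,$$ required to hold by virtue of the equation for $u$ and its differential consequences. Here $U$ may depend on the independent variables, on $u$ and finitely many of its derivatives, and possibly also on nonlocal variables, i.e. on additional variables to which the total derivatives are extended so that they still commute (a differential covering). $\tilde U$ may involve further nonlocal variables. All functions are assumed locally meromorphic in their arguments. A recursion operator is understood as a Bäcklund auto-transformation of the linearized equation, i.e. a system of relations between $U$ and $\tilde U$ sending solutions $U$ to solutions $\tilde U$. *)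

theory Defs
  imports "HOL-Analysis.Analysis" "HOL-Library.Multiset"
begin

datatype ivar = X | Y | Z | R | S | T

text \<open>Coordinates on (a covering of) the infinite jet space. A multi-index is a multiset of
  independent variables: \<open>Jet {#S, T#}\<close> is the coordinate \<open>u\<^sub>s\<^sub>t\<close>, and \<open>Jet {#}\<close> is \<open>u\<close>.\<close>

datatype 'w coord = Indep ivar | Jet "ivar multiset" | Nonlocal 'w

type_synonym 'w point = "'w coord \<Rightarrow> complex"

type_synonym 'w func = "'w point \<Rightarrow> complex"

definition u :: "ivar list \<Rightarrow> 'w func" where
  "u is p = p (Jet (mset is))"

definition pd :: "'w coord \<Rightarrow> 'w func \<Rightarrow> 'w func" where
  "pd c f p = deriv (\<lambda>\<zeta>. f (p(c := \<zeta>))) (p c)"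

text \<open>The sums in the total derivatives are finite wherever the function locally
  depends on finitely many coordinates.\<close>

definition jet_D :: "ivar \<Rightarrow> 'w func \<Rightarrow> 'w func" where
  "jet_D i f p = pd (Indep i) f p
     + (\<Sum>\<alpha> | pd (Jet \<alpha>) f p \<noteq> 0. p (Jet (add_mset i \<alpha>)) * pd (Jet \<alpha>) f p)"

definition eqn :: "'w func" where
  "eqn p = u [S] p * u [Z, T] p - u [Z] p * u [S, T] p - u [S] p * u [X, Y] p
         + u [Y] p * u [S, X] p - u [Y] p * u [R, Z] p + u [Z] p * u [R, Y] p"

inductive_set consequences :: "'w func set" where
  "eqn \<in> consequences"
| "G \<in> consequences \<Longrightarrow> jet_D i G \<in> consequences"

definition equation_manifold :: "'w point set" where
  "equation_manifold = {p. (\<forall>G \<in> consequences. G p = 0) \<and> u [S] p \<noteq> 0}"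

text \<open>A covering has a set of nonlocal variables (local functions: the empty set), an open
  domain, on which everything is considered (open in the product topology, i.e. the
  projective limit topology of the jet spaces), and coefficients, \<open>nl_coeff C i w\<close> being the
  \<open>i\<close>-th total derivative of the nonlocal variable \<open>w\<close>. Coordinates \<open>Nonlocal w\<close> with \<open>w\<close>
  outside \<open>nl_vars C\<close> are dummies on which no function on the covering depends.\<close>

record 'w covering =
  nl_vars :: "'w set"
  cov_dom :: "'w point set"
  nl_coeff :: "ivar \<Rightarrow> 'w \<Rightarrow> 'w func"

definition total_D :: "'w covering \<Rightarrow> ivar \<Rightarrow> 'w func \<Rightarrow> 'w func" where
  "total_D C i f p = jet_D i f p
     + (\<Sum>w | w \<in> nl_vars C \<and> pd (Nonlocal w) f p \<noteq> 0.
          nl_coeff C i w p * pd (Nonlocal w) f p)"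

definition manifold :: "'w covering \<Rightarrow> 'w point set" where
  "manifold C = cov_dom C \<inter> equation_manifold"

definition coords :: "'w covering \<Rightarrow> 'w coord set" where
  "coords C = range Indep \<union> range Jet \<union> Nonlocal ` nl_vars C"

text \<open>Holomorphy in several variables, as continuity together with holomorphy in each variable.\<close>

definition holomorphic_func :: "'w covering \<Rightarrow> 'w point set \<Rightarrow> 'w func \<Rightarrow> bool" where
  "holomorphic_func C V f \<longleftrightarrow>
     (\<exists>J. finite J \<and> J \<subseteq> coords C \<and>
        (\<forall>p \<in> V. \<forall>q \<in> V. (\<forall>c \<in> J. p c = q c) \<longrightarrow> f p = f q)) \<and>
     continuous_on V f \<and>
     (\<forall>p \<in> V. \<forall>c. (\<lambda>\<zeta>. f (p(c := \<zeta>))) field_differentiable at (p c))"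

text \<open>The value of a meromorphic function at a zero of the denominator is arbitrary. The
  denominator must not vanish identically on any open piece of the equation manifold.\<close>

definition meromorphic_func :: "'w covering \<Rightarrow> 'w func \<Rightarrow> bool" where
  "meromorphic_func C f \<longleftrightarrow>
     (\<forall>p \<in> manifold C. \<exists>V g h. open V \<and> p \<in> V \<and>
        holomorphic_func C V g \<and> holomorphic_func C V h \<and>
        V \<inter> manifold C \<subseteq> closure {q \<in> V \<inter> manifold C. h q \<noteq> 0} \<and>
        (\<forall>q \<in> V. h q \<noteq> 0 \<longrightarrow> f q = g q / h q))"

text \<open>Identities between meromorphic functions are identities on a dense relatively open subset
  of the equation manifold. Restricting to that manifold is what ``by virtue of the equation
  and its differential consequences'' means.\<close>

definition generically :: "'w covering \<Rightarrow> ('w point \<Rightarrow> bool) \<Rightarrow> bool" where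
  "generically C P \<longleftrightarrow>
     (\<exists>V. open V \<and> manifold C \<subseteq> closure (V \<inter> manifold C) \<and> (\<forall>p \<in> V \<inter> manifold C. P p))"

definition differential_covering :: "'w covering \<Rightarrow> bool" where
  "differential_covering C \<longleftrightarrow>
     open (cov_dom C) \<and>
     (\<forall>i. \<forall>w \<in> nl_vars C. meromorphic_func C (nl_coeff C i w)) \<and>
     (\<forall>f i j. meromorphic_func C f \<longrightarrow>
        generically C (\<lambda>p. total_D C i (total_D C j f) p = total_D C j (total_D C i f) p))"

text \<open>\<open>C'\<close> has all the nonlocal variables of \<open>C\<close>, with the same total derivatives, and possibly
  further ones. A function on \<open>C\<close> is then literally also a function on \<open>C'\<close>.\<close>

definition covers :: "'w covering \<Rightarrow> 'w covering \<Rightarrow> bool" where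
  "covers C' C \<longleftrightarrow>
     differential_covering C \<and> differential_covering C' \<and>
     nl_vars C \<subseteq> nl_vars C' \<and> cov_dom C' \<subseteq> cov_dom C \<and>
     (\<forall>i. \<forall>w \<in> nl_vars C. \<forall>p \<in> cov_dom C'. nl_coeff C' i w p = nl_coeff C i w p)"

definition linearization :: "'w covering \<Rightarrow> 'w func \<Rightarrow> 'w func" where
  "linearization C U p =
     (let D = (\<lambda>i. total_D C i U p); DD = (\<lambda>i j. total_D C i (total_D C j U) p) in
        u [S] p * DD Z T + u [Z, T] p * D S - u [Z] p * DD S T - u [S, T] p * D Z
      - u [S] p * DD X Y - u [X, Y] p * D S + u [Y] p * DD S X + u [S, X] p * D Y
      - u [Y] p * DD R Z - u [R, Z] p * D Y + u [Z] p * DD R Y + u [R, Y] p * D Z)"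

definition symmetry :: "'w covering \<Rightarrow> 'w func \<Rightarrow> bool" where
  "symmetry C U \<longleftrightarrow> meromorphic_func C U \<and> generically C (\<lambda>p. linearization C U p = 0)"

text \<open>A system of relations between \<open>U\<close> and \<open>V\<close>, stated on a covering on which both live.\<close>

definition recursion_operator :: "('w covering \<Rightarrow> 'w func \<Rightarrow> 'w func \<Rightarrow> bool) \<Rightarrow> bool" where
  "recursion_operator Rel \<longleftrightarrow>
     (\<forall>C C' U V. covers C' C \<longrightarrow> symmetry C U \<longrightarrow> meromorphic_func C' V \<longrightarrow> Rel C' U V \<longrightarrow>
        symmetry C' V)"

end

theory Submission
  imports Defs "HOL-Complex_Analysis.Cauchy_Integral_Formula"
begin

text \<open>Multiplied by \<open>u\<^sub>s\<close>, the relations read \<open>A = 0\<close> and \<open>B = 0\<close> with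
  \<open>A = u\<^sub>s V\<^sub>z - u\<^sub>z V\<^sub>s + \<dots>\<close> and \<open>B = u\<^sub>s V\<^sub>y - u\<^sub>y V\<^sub>s + \<dots>\<close>. The linearization of \<open>V\<close> is a
  combination of \<open>A\<close>, \<open>B\<close>, \<open>D\<^sub>t A\<close>, \<open>D\<^sub>r A\<close>, \<open>D\<^sub>x B\<close>, \<open>D\<^sub>r B\<close>, the equation and its \<open>r\<close>-derivative.

  The relations hold on the equation manifold only, so differentiating them requires that total
  derivatives be tangent to it. The equation and its consequences can be solved for the jets
  \<open>u\<^sub>z\<^sub>t\<^sub>\<alpha>\<close>; moving the remaining coordinates along a straight line in the direction of a total
  derivative and solving for these jets yields a curve in the manifold whose velocity is the
  total derivative at the given point. A function vanishing on the manifold is constant on this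
  curve, and the chain rule applies because a continuous separately holomorphic function has
  continuous partial derivatives.\<close>

subsection \<open>Separately holomorphic functions\<close>

text \<open>The analytic half of \<open>holomorphic_func\<close>. Dependence on finitely many
  coordinates is split off as \<open>depends_on\<close>, because the results on partial derivatives
  are purely analytic and hold in infinitely many coordinates.\<close>

definition separately_holomorphic :: "'w point set \<Rightarrow> 'w func \<Rightarrow> bool" where
  "separately_holomorphic V f \<longleftrightarrow> continuous_on V f \<and>
     (\<forall>p \<in> V. \<forall>c. (\<lambda>\<zeta>. f (p(c := \<zeta>))) field_differentiable at (p c))"

(* It would split a function update into its coordinates before the next rule applies. *)
declare continuous_on_coordinatewise_then_product [continuous_intros del]

lemma continuous_on_fun_upd [continuous_intros]:
  fixes f :: "'a::topological_space \<Rightarrow> 'i \<Rightarrow> 'b::topological_space"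
  assumes "continuous_on A f" "continuous_on A g"
  shows "continuous_on A (\<lambda>x. (f x)(c := g x))"
proof (rule continuous_on_coordinatewise_then_product)
  fix i
  show "continuous_on A (\<lambda>x. ((f x)(c := g x)) i)"
    using assms continuous_on_product_then_coordinatewise[OF assms(1)] by (cases "i = c") auto
qed

lemma continuous_on_fst_coordinate [continuous_intros]:
  fixes A :: "(('i \<Rightarrow> 'b::topological_space) \<times> 'a::topological_space) set"
  shows "continuous_on A (\<lambda>x. fst x i)"
  by (rule continuous_on_product_then_coordinatewise) (intro continuous_intros)

lemma has_field_derivative_pd:
  assumes "separately_holomorphic V f" "p(c := a) \<in> V"
  shows "((\<lambda>\<zeta>. f (p(c := \<zeta>))) has_field_derivative pd c f (p(c := a))) (at a)"
proof -
  have "(\<lambda>\<zeta>. f ((p(c := a))(c := \<zeta>))) field_differentiable at ((p(c := a)) c)"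
    using assms unfolding separately_holomorphic_def by blast
  then have "(\<lambda>\<zeta>. f (p(c := \<zeta>))) field_differentiable at a" by simp
  moreover have "pd c f (p(c := a)) = deriv (\<lambda>\<zeta>. f (p(c := \<zeta>))) a"
    by (simp add: pd_def)
  ultimately show ?thesis
    by (simp add: field_differentiable_derivI)
qed

lemma has_field_derivative_pd_shift:
  assumes "separately_holomorphic V f" "p(c := a + w) \<in> V"
  shows "((\<lambda>\<zeta>. f (p(c := a + \<zeta>))) has_field_derivative pd c f (p(c := a + w))) (at w)"
  using has_field_derivative_pd[OF assms] DERIV_shift[of "\<lambda>\<zeta>. f (p(c := \<zeta>))" _ w a]
  by (simp add: add.commute)

text \<open>The shift is jointly continuous in \<open>(q, w)\<close>, so one radius serves all base
  points near \<open>p\<close>. This makes the later estimates uniform.\<close>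

lemma shift_neighbourhood:
  fixes V :: "('i \<Rightarrow> complex) set"
  assumes "open V" "p \<in> V"
  obtains U r where "open U" "p \<in> U" "r > 0"
    "\<And>q w. q \<in> U \<Longrightarrow> w \<in> cball 0 r \<Longrightarrow> q(c := q c + w) \<in> V"
proof -
  let ?g = "\<lambda>x::('i \<Rightarrow> complex) \<times> complex. (fst x)(c := fst x c + snd x)"
  have "continuous_on UNIV ?g"
    by (intro continuous_intros)
  then have "open (?g -` V)"
    using assms(1) by (rule open_vimage[rotated])
  moreover have "(p, 0) \<in> ?g -` V"
    using assms(2) by simp
  ultimately obtain U W where UW: "open U" "open W" "(p, 0) \<in> U \<times> W" "U \<times> W \<subseteq> ?g -` V"
    by (rule open_prod_elim)
  then obtain r where r: "r > 0" "cball 0 r \<subseteq> W"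
    using open_contains_cball by (metis mem_Sigma_iff)
  show ?thesis
  proof (rule that[OF UW(1) _ r(1)])
    show "p \<in> U" using UW by simp
    fix q and w :: complex assume "q \<in> U" "w \<in> cball 0 r"
    then have "(q, w) \<in> ?g -` V" using UW r by blast
    then show "q(c := q c + w) \<in> V" by simp
  qed
qed

text \<open>By compactness of the closed disc, the slices of \<open>f\<close> in direction
  \<open>c\<close> through points \<open>q\<close> converge uniformly to the slice through
  \<open>p\<close> as \<open>q\<close> tends to \<open>p\<close>. By Weierstrass, derivatives of
  uniformly convergent holomorphic functions converge too.\<close>

lemma tendsto_pd:
  assumes V: "open V" "p \<in> V" and f: "separately_holomorphic V f"
  shows "(pd c f \<longlongrightarrow> pd c f p) (nhds p)"
proof -
  obtain U r where U: "open U" "p \<in> U" and r: "r > 0"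
    and UV: "\<And>q w. q \<in> U \<Longrightarrow> w \<in> cball 0 r \<Longrightarrow> q(c := q c + w) \<in> V"
    using shift_neighbourhood[OF V] by metis
  define \<Phi> where "\<Phi> = (\<lambda>x. f ((fst x)(c := fst x c + snd x)))"
  have contf: "continuous_on V f" using f by (simp add: separately_holomorphic_def)
  have cont: "continuous_on (U \<times> cball 0 r) \<Phi>"
    unfolding \<Phi>_def
    by (rule continuous_on_compose2[OF contf]) (use UV in \<open>auto intro!: continuous_intros\<close>)
  have der: "((\<lambda>w. \<Phi> (q, w)) has_field_derivative pd c f (q(c := q c + w))) (at w)"
    if "q \<in> U" "w \<in> cball 0 r" for q w
    unfolding \<Phi>_def using has_field_derivative_pd_shift[OF f UV[OF that]] by simp
  have evU: "\<forall>\<^sub>F q in nhds p. q \<in> U"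
    using U by (simp add: eventually_nhds_in_open)
  have lim: "uniform_limit (cball 0 r) (\<lambda>q w. \<Phi> (q, w)) (\<lambda>w. \<Phi> (p, w)) (nhds p)"
    unfolding uniform_limit_iff
  proof (intro allI impI)
    fix e :: real assume e: "e > 0"
    obtain X0 where X0: "p \<in> X0" "open X0"
      "\<forall>x\<in>X0 \<inter> U. \<forall>t\<in>cball 0 r. dist (\<Phi> (x, t)) (\<Phi> (p, t)) \<le> e / 2"
      by (rule continuous_on_prod_compactE[OF cont compact_cball U(2) half_gt_zero[OF e]])
    have "\<forall>\<^sub>F q in nhds p. q \<in> X0"
      using X0 by (simp add: eventually_nhds_in_open)
    with evU show "\<forall>\<^sub>F q in nhds p. \<forall>w\<in>cball 0 r. dist (\<Phi> (q, w)) (\<Phi> (p, w)) < e"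
    proof eventually_elim
      case (elim q)
      then have "\<forall>w\<in>cball 0 r. dist (\<Phi> (q, w)) (\<Phi> (p, w)) \<le> e / 2"
        using X0(3) by blast
      moreover have "e / 2 < e" using e by simp
      ultimately show ?case by (meson le_less_trans)
    qed
  qed
  have ev: "\<forall>\<^sub>F q in nhds p. continuous_on (cball 0 r) (\<lambda>w. \<Phi> (q, w)) \<and>
      (\<forall>w\<in>ball 0 r. ((\<lambda>w. \<Phi> (q, w)) has_field_derivative pd c f (q(c := q c + w))) (at w))"
    using evU
  proof eventually_elim
    case (elim q)
    have "continuous_on (cball 0 r) (\<lambda>w. \<Phi> (q, w))"
      by (rule continuous_on_compose2[OF cont]) (use elim in \<open>auto intro!: continuous_intros\<close>)
    then show ?case using der[OF elim] by auto
  qed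
  obtain g' where g': "\<And>w. w \<in> ball 0 r \<Longrightarrow>
      ((\<lambda>w. \<Phi> (p, w)) has_field_derivative g' w) (at w) \<and>
      ((\<lambda>q. pd c f (q(c := q c + w))) \<longlongrightarrow> g' w) (nhds p)"
    using has_complex_derivative_uniform_limit[OF ev lim _ r] by auto
  have "g' 0 = pd c f p"
    using DERIV_unique[OF _ der[OF U(2), of 0]] g'[of 0] r by auto
  then show ?thesis using g'[of 0] r by simp
qed

lemma continuous_on_pd:
  assumes "open V" "separately_holomorphic V f"
  shows "continuous_on V (pd c f)"
  unfolding continuous_on_def
  using tendsto_pd[OF assms(1) _ assms(2)] tendsto_mono[OF at_within_le_nhds] by blast

text \<open>For \<open>c = c'\<close> this is holomorphy of the derivative in one variable.
  Otherwise the difference quotients of \<open>f\<close> in direction \<open>c'\<close> converge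
  uniformly along a disc in direction \<open>c\<close>; by Weierstrass their
  \<open>c\<close>-derivatives, which are difference quotients of \<open>pd c f\<close> in direction
  \<open>c'\<close>, converge as well.\<close>

lemma field_differentiable_pd:
  assumes V: "open V" "p \<in> V" and f: "separately_holomorphic V f"
  shows "(\<lambda>\<zeta>. pd c f (p(c' := \<zeta>))) field_differentiable at (p c')"
proof (cases "c = c'")
  case True
  let ?S = "(\<lambda>\<zeta>. p(c := \<zeta>)) -` V"
  have "continuous_on UNIV (\<lambda>\<zeta>. p(c := \<zeta>))"
    by (intro continuous_intros)
  then have S: "open ?S" using V(1) by (rule open_vimage[rotated])
  have "(\<lambda>\<zeta>. f (p(c := \<zeta>))) holomorphic_on ?S"
    using has_field_derivative_pd[OF f] S by (auto simp: holomorphic_on_open)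
  then have "deriv (\<lambda>\<zeta>. f (p(c := \<zeta>))) holomorphic_on ?S"
    using S by (rule holomorphic_deriv)
  moreover have "p c \<in> ?S" using V by simp
  ultimately have "deriv (\<lambda>\<zeta>. f (p(c := \<zeta>))) field_differentiable at (p c)"
    using S by (meson holomorphic_on_imp_differentiable_at)
  moreover have "(\<lambda>\<zeta>. pd c f (p(c := \<zeta>))) = deriv (\<lambda>\<zeta>. f (p(c := \<zeta>)))"
    by (simp add: pd_def fun_eq_iff)
  ultimately show ?thesis using True by simp
next
  case False
  let ?pt = "\<lambda>h w. p(c' := p c' + h, c := p c + w)"
  obtain U1 r1 where 1: "open U1" "p \<in> U1" "r1 > 0"
    "\<And>q w. q \<in> U1 \<Longrightarrow> w \<in> cball 0 r1 \<Longrightarrow> q(c := q c + w) \<in> V"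
    using shift_neighbourhood[OF V] by metis
  obtain U2 r2 where 2: "open U2" "p \<in> U2" "r2 > 0"
    "\<And>q w. q \<in> U2 \<Longrightarrow> w \<in> cball 0 r2 \<Longrightarrow> q(c' := q c' + w) \<in> U1"
    using shift_neighbourhood[OF 1(1,2)] by metis
  define r where "r = min r1 r2"
  have r: "r > 0" using 1 2 by (simp add: r_def)
  have inV: "?pt h w \<in> V" if "h \<in> cball 0 r" "w \<in> cball 0 r" for h w
    using 1(4)[of "p(c' := p c' + h)" w] 2(4)[of p h] 2(2) that False by (simp add: r_def)
  define g where "g = (\<lambda>w. pd c' f (?pt 0 w))"
  define F where "F = (\<lambda>h w. (f (?pt h w) - f (?pt 0 w)) / h)"
  define F' where "F' = (\<lambda>h w. (pd c f (?pt h w) - pd c f (?pt 0 w)) / h)"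
  have cont: "continuous_on (cball 0 r \<times> cball 0 r) (\<lambda>x. pd c' f (?pt (fst x) (snd x)))"
    by (rule continuous_on_compose2[OF continuous_on_pd[OF V(1) f]])
       (use inV in \<open>auto intro!: continuous_intros\<close>)
  have contf: "continuous_on V f" using f by (simp add: separately_holomorphic_def)
  have small: "\<forall>\<^sub>F h in at 0. h \<in> ball 0 d" if "d > 0" for d :: real
    by (rule eventually_at_in_open') (use that in auto)
  have "uniform_limit (cball 0 r) F g (at 0)"
    unfolding uniform_limit_iff
  proof (intro allI impI)
    fix e :: real assume e: "e > 0"
    obtain X0 where X0: "0 \<in> X0" "open X0"
      "\<forall>h\<in>X0 \<inter> cball 0 r. \<forall>w\<in>cball 0 r. dist (pd c' f (?pt h w)) (pd c' f (?pt 0 w)) \<le> e / 2"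
      by (rule continuous_on_prod_compactE[OF cont compact_cball _ half_gt_zero[OF e], of 0])
         (use r in simp_all)
    then obtain d0 where d0: "d0 > 0" "ball 0 d0 \<subseteq> X0"
      by (meson open_contains_ball)
    define d where "d = min d0 r"
    have d: "d > 0" "ball 0 d \<subseteq> X0 \<inter> cball 0 r" using d0 r by (auto simp: d_def)
    have bound: "dist (F h w) (g w) \<le> e / 2" if h: "h \<in> ball 0 d" "h \<noteq> 0" and w: "w \<in> cball 0 r" for h w
    proof -
      \<comment> \<open>Subtracting the linear function with slope \<open>g w\<close> turns the mean
        value inequality into a bound on the error of the difference quotient.\<close>
      let ?k = "\<lambda>h. f (?pt h w) - g w * h"
      have "norm (?k h - ?k 0) \<le> e / 2 * norm (h - 0)"
      proof (rule field_differentiable_bound[of "ball 0 d" ?k "\<lambda>h. pd c' f (?pt h w) - g w"])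
        fix z :: complex assume z: "z \<in> ball 0 d"
        have swap: "(p(c := p c + w))(c' := x) = p(c' := x, c := p c + w)" for x
          using False by (auto simp: fun_upd_def)
        have "(p(c := p c + w))(c' := p c' + z) \<in> V"
          unfolding swap using inV[of z w] z d w by auto
        from has_field_derivative_pd_shift[OF f this]
        have "((\<lambda>h. f (?pt h w)) has_field_derivative pd c' f (?pt z w)) (at z)"
          unfolding swap .
        then show "(?k has_field_derivative (pd c' f (?pt z w) - g w)) (at z within ball 0 d)"
          by (rule has_field_derivative_at_within[OF DERIV_diff[OF _ DERIV_cmult_Id]])
        have "z \<in> X0 \<inter> cball 0 r" using d(2) z by blast
        with X0(3) w have "dist (pd c' f (?pt z w)) (pd c' f (?pt 0 w)) \<le> e / 2" by blast
        then show "norm (pd c' f (?pt z w) - g w) \<le> e / 2"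
          by (simp only: g_def dist_norm)
      qed (use h(1) d(1) in simp_all)
      moreover have "F h w - g w = (?k h - ?k 0) / h"
        using h by (simp add: F_def field_simps)
      ultimately have "norm (F h w - g w) \<le> (e / 2 * norm h) / norm h"
        using h(2) by (simp only: norm_divide divide_right_mono norm_ge_zero diff_zero)
      then show ?thesis
        using h(2) by (simp add: dist_norm)
    qed
    have "\<forall>\<^sub>F h::complex in at 0. h \<noteq> 0" by (simp add: eventually_at_filter)
    with small[OF d(1)] show "\<forall>\<^sub>F h in at 0. \<forall>w\<in>cball 0 r. dist (F h w) (g w) < e"
    proof eventually_elim
      case (elim h)
      then have "\<forall>w\<in>cball 0 r. dist (F h w) (g w) \<le> e / 2"
        using bound by blast
      moreover have "e / 2 < e" using e by simp
      ultimately show ?case by (meson le_less_trans)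
    qed
  qed
  moreover have "\<forall>\<^sub>F h in at 0. continuous_on (cball 0 r) (F h) \<and>
      (\<forall>w\<in>ball 0 r. (F h has_field_derivative F' h w) (at w))"
  proof -
    have *: "continuous_on (cball 0 r) (\<lambda>w. f (?pt h w))" if "h \<in> cball 0 r" for h
      by (rule continuous_on_compose2[OF contf]) (use inV that in \<open>auto intro!: continuous_intros\<close>)
    have **: "((\<lambda>w. f (?pt h w)) has_field_derivative pd c f (?pt h w)) (at w)"
      if "h \<in> cball 0 r" "w \<in> cball 0 r" for h w
      using has_field_derivative_pd_shift[OF f, of "p(c' := p c' + h)" c "p c" w] inV[OF that] by simp
    have "\<forall>\<^sub>F h::complex in at 0. h \<noteq> 0" by (simp add: eventually_at_filter)
    with small[OF r] show ?thesis
    proof eventually_elim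
      case (elim h)
      then have "continuous_on (cball 0 r) (F h)"
        unfolding F_def using r by (intro continuous_intros *) auto
      moreover have "(F h has_field_derivative F' h w) (at w)" if "w \<in> ball 0 r" for w
        unfolding F_def F'_def
        by (rule DERIV_cdivide[OF DERIV_diff[OF ** **]]) (use elim that r in auto)
      ultimately show ?case by auto
    qed
  qed
  ultimately obtain g' where "\<And>w. w \<in> ball 0 r \<Longrightarrow>
      (g has_field_derivative g' w) (at w) \<and> ((\<lambda>h. F' h w) \<longlongrightarrow> g' w) (at 0)"
    using has_complex_derivative_uniform_limit[of 0 r F F' "at 0" g] r at_neq_bot by blast
  then have "((\<lambda>h. F' h 0) \<longlongrightarrow> g' 0) (at 0)"
    using r by simp
  then have "((\<lambda>\<zeta>. pd c f (p(c' := \<zeta>))) has_field_derivative g' 0) (at (p c'))"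
    using False by (simp add: DERIV_def F'_def fun_upd_idem)
  then show ?thesis
    using field_differentiable_def by blast
qed

lemma separately_holomorphic_pd:
  assumes "open V" "separately_holomorphic V f"
  shows "separately_holomorphic V (pd c f)"
  using continuous_on_pd[OF assms] field_differentiable_pd[OF assms(1) _ assms(2)]
  by (auto simp: separately_holomorphic_def)

section \<open>The chain rule along a curve in the space of points\<close>

text \<open>Convergence in the product topology is coordinatewise, so this also covers curves along
  which infinitely many jets move.\<close>

lemma eventually_curve_in:
  fixes \<delta> :: "'a::t2_space \<Rightarrow> 'i \<Rightarrow> 'b::topological_space"
  assumes "\<And>c. isCont (\<lambda>\<zeta>. \<delta> \<zeta> c) x" "open W" "\<delta> x \<in> W"
  shows "\<forall>\<^sub>F \<zeta> in nhds x. \<delta> \<zeta> \<in> W"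
proof -
  have "(\<delta> \<longlongrightarrow> \<delta> x) (at x)"
    using assms(1) unfolding isCont_def limitin_canonical_iff[symmetric]
      euclidean_product_topology[symmetric] limitin_componentwise by auto
  then have "\<forall>\<^sub>F \<zeta> in at x. \<delta> \<zeta> \<in> W"
    using assms(2,3) by (rule topological_tendstoD)
  then show ?thesis
    using assms(3) by (simp add: eventually_nhds_conv_at)
qed

text \<open>Induction on \<open>K\<close> releases one coordinate at a time. The increment due to
  the new coordinate is put in Caratheodory form, slope times displacement. The other coordinates of
  \<open>K\<close> move meanwhile, so continuity of the slope rests on joint continuity of
  \<open>pd c f\<close>.\<close>

lemma has_field_derivative_along_curve:
  assumes V: "open V" "p \<in> V" and f: "separately_holomorphic V f"
    and \<delta>: "\<And>c. ((\<lambda>\<zeta>. \<delta> \<zeta> c) has_field_derivative v c) (at 0)" "\<delta> 0 = p"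
    and K: "finite K"
  shows "((\<lambda>\<zeta>. f (\<lambda>c. if c \<in> K then \<delta> \<zeta> c else p c)) has_field_derivative
           (\<Sum>c\<in>K. pd c f p * v c)) (at 0)"
  using K
proof (induction K rule: finite_induct)
  case empty
  then show ?case by simp
next
  case (insert c K)
  let ?q = "\<lambda>\<zeta> c. if c \<in> K then \<delta> \<zeta> c else p c"
  let ?G = "\<lambda>\<zeta>. (?q \<zeta>)(c := \<delta> \<zeta> c)"
  have q0: "?q 0 = p" using \<delta>(2) by auto
  have cont\<delta>: "isCont (\<lambda>\<zeta>. \<delta> \<zeta> c) 0" for c
    using \<delta>(1) by (rule DERIV_isCont)
  \<comment> \<open>The Caratheodory slope in direction \<open>c\<close>, with base point
    \<open>?q \<zeta>\<close>. Where the displacement vanishes it is given its limit value, so that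
    it can be continuous at 0.\<close>
  define k where "k = (\<lambda>\<zeta>. if \<delta> \<zeta> c = p c then pd c f p
                        else (f (?G \<zeta>) - f (?q \<zeta>)) / (\<delta> \<zeta> c - p c))"
  have k0: "k 0 = pd c f p" by (simp add: k_def \<delta>(2))
  have "isCont k 0"
    unfolding isCont_def k0 tendsto_iff
  proof (intro allI impI)
    fix e :: real assume e: "e > 0"
    have contpd: "continuous_on V (pd c f)" using V(1) f by (rule continuous_on_pd)
    \<comment> \<open>On \<open>?W\<close> the partial derivative is within \<open>e / 2\<close> of
      its value at \<open>p\<close>; a whole disc in direction \<open>c\<close> around each nearby
      base point stays in \<open>?W\<close>, so the mean value inequality applies there.\<close>
    let ?W = "{x \<in> V. pd c f x \<in> ball (pd c f p) (e / 2)}"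
    have "?W = V \<inter> pd c f -` ball (pd c f p) (e / 2)" by auto
    then have W: "open ?W" "p \<in> ?W"
      using continuous_open_preimage[OF contpd V(1), of "ball (pd c f p) (e / 2)"] V(2) e by simp_all
    obtain U r where U: "open U" "p \<in> U" "r > 0"
      "\<And>q w. q \<in> U \<Longrightarrow> w \<in> cball 0 r \<Longrightarrow> q(c := q c + w) \<in> ?W"
      by (rule shift_neighbourhood[OF W, where c = c]) blast
    have qc: "?q \<zeta> c = p c" for \<zeta> using insert.hyps by simp
    have bound: "norm (f (?G \<zeta>) - f (?q \<zeta>) - pd c f p * (\<delta> \<zeta> c - p c)) \<le> e / 2 * norm (\<delta> \<zeta> c - p c)"
      if "?q \<zeta> \<in> U" "\<delta> \<zeta> c - p c \<in> cball 0 r" for \<zeta>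
    proof -
      let ?k = "\<lambda>w. f ((?q \<zeta>)(c := ?q \<zeta> c + w)) - pd c f p * w"
      have "norm (?k (\<delta> \<zeta> c - p c) - ?k 0) \<le> e / 2 * norm ((\<delta> \<zeta> c - p c) - 0)"
      proof (rule field_differentiable_bound[of "cball 0 r" ?k
               "\<lambda>w. pd c f ((?q \<zeta>)(c := ?q \<zeta> c + w)) - pd c f p"])
        fix w :: complex assume w: "w \<in> cball 0 r"
        have inW: "(?q \<zeta>)(c := ?q \<zeta> c + w) \<in> ?W" by (rule U(4)[OF that(1) w])
        then have inV: "(?q \<zeta>)(c := ?q \<zeta> c + w) \<in> V" by blast
        show "(?k has_field_derivative pd c f ((?q \<zeta>)(c := ?q \<zeta> c + w)) - pd c f p)
                (at w within cball 0 r)"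
          by (rule has_field_derivative_at_within
                [OF DERIV_diff[OF has_field_derivative_pd_shift[OF f inV] DERIV_cmult_Id]])
        have "dist (pd c f p) (pd c f ((?q \<zeta>)(c := ?q \<zeta> c + w))) < e / 2"
          using inW by simp
        then show "norm (pd c f ((?q \<zeta>)(c := ?q \<zeta> c + w)) - pd c f p) \<le> e / 2"
          by (simp add: dist_norm norm_minus_commute)
      qed (use that(2) U(3) in simp_all)
      moreover have "(?q \<zeta>)(c := ?q \<zeta> c + (\<delta> \<zeta> c - p c)) = ?G \<zeta>"
        unfolding qc by (simp add: algebra_simps)
      moreover have "(?q \<zeta>)(c := ?q \<zeta> c + 0) = ?q \<zeta>" by auto
      ultimately show ?thesis by (simp add: algebra_simps)
    qed
    have "isCont (\<lambda>\<zeta>. ?q \<zeta> i) 0" for i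
      using cont\<delta>[of i] by (cases "i \<in> K") simp_all
    then have "\<forall>\<^sub>F \<zeta> in nhds 0. ?q \<zeta> \<in> U"
      by (rule eventually_curve_in) (use U(1,2) q0 in auto)
    then have "\<forall>\<^sub>F \<zeta> in at 0. ?q \<zeta> \<in> U"
      by (simp add: eventually_nhds_conv_at)
    moreover have "\<forall>\<^sub>F \<zeta> in at 0. \<delta> \<zeta> c \<in> ball (p c) r"
      using cont\<delta>[of c] U(3) \<delta>(2) unfolding isCont_def tendsto_def
      by (metis centre_in_ball open_ball)
    ultimately show "\<forall>\<^sub>F \<zeta> in at 0. dist (k \<zeta>) (pd c f p) < e"
    proof eventually_elim
      case (elim \<zeta>)
      show ?case
      proof (cases "\<delta> \<zeta> c = p c")
        case True
        then show ?thesis using e by (simp add: k_def)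
      next
        case False
        have "\<delta> \<zeta> c - p c \<in> cball 0 r"
          using elim(2) by (simp add: dist_norm norm_minus_commute)
        note b = bound[OF elim(1) this]
        have "k \<zeta> - pd c f p = (f (?G \<zeta>) - f (?q \<zeta>) - pd c f p * (\<delta> \<zeta> c - p c)) / (\<delta> \<zeta> c - p c)"
          using False by (simp add: k_def diff_divide_distrib)
        then have "norm (k \<zeta> - pd c f p) \<le> (e / 2 * norm (\<delta> \<zeta> c - p c)) / norm (\<delta> \<zeta> c - p c)"
          using b by (simp only: norm_divide divide_right_mono norm_ge_zero)
        also have "\<dots> < e" using False e by simp
        finally show ?thesis by (simp add: dist_norm)
      qed
    qed
  qed
  moreover have "f (?G \<zeta>) - f (?q \<zeta>) = k \<zeta> * (\<delta> \<zeta> c - p c)" for \<zeta>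
  proof (cases "\<delta> \<zeta> c = p c")
    case True
    then have "?G \<zeta> = ?q \<zeta>" using insert.hyps by auto
    then show ?thesis using True by simp
  next
    case False
    then show ?thesis by (simp add: k_def)
  qed
  moreover obtain m where m: "\<And>\<zeta>. \<delta> \<zeta> c - p c = m \<zeta> * \<zeta>" "isCont m 0" "m 0 = v c"
    using \<delta>(1)[of c] \<delta>(2) unfolding CARAT_DERIV by auto
  ultimately have "((\<lambda>\<zeta>. f (?G \<zeta>) - f (?q \<zeta>)) has_field_derivative pd c f p * v c) (at 0)"
    unfolding CARAT_DERIV using k0 q0 \<delta>(2)
    by (intro exI[of _ "\<lambda>\<zeta>. k \<zeta> * m \<zeta>"]) (auto simp: fun_upd_idem)
  from DERIV_add[OF this insert.IH]
  have "((\<lambda>\<zeta>. f (?G \<zeta>)) has_field_derivative pd c f p * v c + (\<Sum>c\<in>K. pd c f p * v c)) (at 0)"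
    by simp
  moreover have "?G \<zeta> = (\<lambda>d. if d \<in> insert c K then \<delta> \<zeta> d else p d)" for \<zeta>
    by auto
  ultimately show ?case using insert.hyps by simp
qed

subsection \<open>Regular points\<close>

definition depends_on :: "'w point set \<Rightarrow> 'w coord set \<Rightarrow> 'w func \<Rightarrow> bool" where
  "depends_on V J f \<longleftrightarrow> (\<forall>p \<in> V. \<forall>q \<in> V. (\<forall>c \<in> J. p c = q c) \<longrightarrow> f p = f q)"

lemma depends_onD:
  "depends_on V J f \<Longrightarrow> p \<in> V \<Longrightarrow> q \<in> V \<Longrightarrow> (\<And>c. c \<in> J \<Longrightarrow> p c = q c) \<Longrightarrow> f p = f q"
  unfolding depends_on_def by (drule (1) bspec, drule (1) bspec, erule mp) simp

lemma holomorphic_func_iff: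
  "holomorphic_func C V f \<longleftrightarrow>
     (\<exists>J. finite J \<and> J \<subseteq> coords C \<and> depends_on V J f) \<and> separately_holomorphic V f"
  by (auto simp: holomorphic_func_def depends_on_def separately_holomorphic_def)

text \<open>A meromorphic function may take arbitrary values at zeros of its denominator. Sum and
  Leibniz rules are therefore applied only at points near which the function itself is
  holomorphic.\<close>

definition regular_at :: "'w covering \<Rightarrow> 'w func \<Rightarrow> 'w point \<Rightarrow> bool" where
  "regular_at C f p \<longleftrightarrow> (\<exists>V. open V \<and> p \<in> V \<and> holomorphic_func C V f)"

lemma regular_atE:
  assumes "regular_at C f p"
  obtains V J where "open V" "p \<in> V" "finite J" "J \<subseteq> coords C" "depends_on V J f"
    "separately_holomorphic V f"
  using assms by (auto simp: regular_at_def holomorphic_func_iff)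

lemma regular_atI:
  assumes "open V" "p \<in> V" "finite J" "J \<subseteq> coords C" "depends_on V J f"
    "separately_holomorphic V f"
  shows "regular_at C f p"
  using assms by (auto simp: regular_at_def holomorphic_func_iff)

lemma eventually_fun_upd_in:
  fixes V :: "'w point set"
  assumes "open V" "p \<in> V"
  shows "\<forall>\<^sub>F \<zeta> in nhds (p c). p(c := \<zeta>) \<in> V"
proof -
  have "continuous_on UNIV (\<lambda>\<zeta>. p(c := \<zeta>))"
    by (intro continuous_intros)
  then have "open ((\<lambda>\<zeta>. p(c := \<zeta>)) -` V)"
    using assms(1) by (rule open_vimage[rotated])
  then have "\<forall>\<^sub>F \<zeta> in nhds (p c). \<zeta> \<in> (\<lambda>\<zeta>. p(c := \<zeta>)) -` V"
    by (rule eventually_nhds_in_open) (use assms in simp)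
  then show ?thesis by simp
qed

lemma pd_const [simp]: "pd c (\<lambda>p. a) p = 0"
  by (simp add: pd_def)

lemma separately_holomorphic_subset:
  assumes "separately_holomorphic V f" "W \<subseteq> V"
  shows "separately_holomorphic W f"
  using assms by (auto simp: separately_holomorphic_def intro: continuous_on_subset)

lemma depends_on_mono:
  assumes "depends_on V J f" "W \<subseteq> V" "J \<subseteq> K"
  shows "depends_on W K f"
  using assms unfolding depends_on_def by (meson subsetD)

lemma separately_holomorphic_cong:
  assumes V: "open V" and f: "separately_holomorphic V f" and eq: "\<And>q. q \<in> V \<Longrightarrow> f q = g q"
  shows "separately_holomorphic V g"
  unfolding separately_holomorphic_def
proof (intro conjI ballI allI)
  show "continuous_on V g"
    using f eq by (simp add: separately_holomorphic_def cong: continuous_on_cong)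
  fix p c assume p: "p \<in> V"
  have f': "((\<lambda>\<zeta>. f (p(c := \<zeta>))) has_field_derivative pd c f p) (at (p c))"
    using has_field_derivative_pd[OF f, of p c "p c"] p by simp
  have "\<forall>\<^sub>F \<zeta> in nhds (p c). f (p(c := \<zeta>)) = g (p(c := \<zeta>))"
    using eventually_fun_upd_in[OF V p, of c] eq by (auto elim!: eventually_mono)
  from DERIV_cong_ev[OF refl this refl] f'
  have "((\<lambda>\<zeta>. g (p(c := \<zeta>))) has_field_derivative pd c f p) (at (p c))"
    by blast
  then show "(\<lambda>\<zeta>. g (p(c := \<zeta>))) field_differentiable at (p c)"
    using field_differentiable_def by blast
qed

lemma pd_eq_0:
  assumes "open V" "p \<in> V" "depends_on V J f" "c \<notin> J"
  shows "pd c f p = 0"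
proof -
  have "deriv (\<lambda>\<zeta>. f (p(c := \<zeta>))) (p c) = deriv (\<lambda>\<zeta>. f p) (p c)"
  proof (rule deriv_cong_ev)
    show "\<forall>\<^sub>F \<zeta> in nhds (p c). f (p(c := \<zeta>)) = f p"
      using eventually_fun_upd_in[OF assms(1,2)]
    proof eventually_elim
      case (elim \<zeta>)
      have "\<forall>d\<in>J. (p(c := \<zeta>)) d = p d" using assms(4) by auto
      then show ?case using assms(2,3) elim unfolding depends_on_def by blast
    qed
  qed simp
  then show ?thesis by (simp add: pd_def)
qed

lemma depends_on_pd:
  assumes V: "open V" and f: "depends_on V J f"
  shows "depends_on V J (pd c f)"
  unfolding depends_on_def
proof (intro ballI impI)
  fix p q assume p: "p \<in> V" and q: "q \<in> V" and eq: "\<forall>d\<in>J. p d = q d"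
  show "pd c f p = pd c f q"
  proof (cases "c \<in> J")
    case True
    then have c: "p c = q c" using eq by blast
    have "\<forall>\<^sub>F \<zeta> in nhds (p c). f (p(c := \<zeta>)) = f (q(c := \<zeta>))"
      using eventually_fun_upd_in[OF V p, of c] eventually_fun_upd_in[OF V q, of c, folded c]
    proof eventually_elim
      case (elim \<zeta>)
      have "\<forall>d\<in>J. (p(c := \<zeta>)) d = (q(c := \<zeta>)) d" using eq by auto
      then show ?case using f elim unfolding depends_on_def by blast
    qed
    then show ?thesis
      unfolding pd_def using c by (intro deriv_cong_ev) auto
  next
    case False
    then show ?thesis using pd_eq_0[OF V _ f] p q by simp
  qed
qed

lemma regular_at_pd:
  assumes "regular_at C f p"
  shows "regular_at C (pd c f) p"
  using assms
proof (rule regular_atE)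
  fix V J assume *: "open V" "p \<in> V" "finite J" "J \<subseteq> coords C" "depends_on V J f"
    "separately_holomorphic V f"
  show ?thesis
    by (rule regular_atI[OF *(1-4) depends_on_pd[OF *(1,5)] separately_holomorphic_pd[OF *(1,6)]])
qed

lemma regular_at_cong:
  assumes W: "open W" "p \<in> W" and eq: "\<And>q. q \<in> W \<Longrightarrow> f q = g q" and f: "regular_at C f p"
  shows "regular_at C g p"
  using f
proof (rule regular_atE)
  fix V J assume *: "open V" "p \<in> V" "finite J" "J \<subseteq> coords C" "depends_on V J f"
    "separately_holomorphic V f"
  show ?thesis
  proof (rule regular_atI[of "V \<inter> W" _ J])
    show "open (V \<inter> W)" using * W by auto
    have "depends_on (V \<inter> W) J f" using *(5) by (rule depends_on_mono) auto
    then show "depends_on (V \<inter> W) J g"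
      unfolding depends_on_def by (metis IntE eq)
    have "separately_holomorphic (V \<inter> W) f" using *(6) by (rule separately_holomorphic_subset) auto
    with \<open>open (V \<inter> W)\<close> show "separately_holomorphic (V \<inter> W) g"
      by (rule separately_holomorphic_cong) (auto simp: eq)
  qed (use * W in auto)
qed

lemma regular_at_const: "regular_at C (\<lambda>p. a) p"
  by (rule regular_atI[of UNIV _ "{}"]) (auto simp: depends_on_def separately_holomorphic_def)

lemma regular_at_coordinate:
  assumes "c \<in> coords C"
  shows "regular_at C (\<lambda>p. p c) p"
proof (rule regular_atI[of UNIV _ "{c}"])
  have "(\<lambda>\<zeta>. (p(d := \<zeta>)) c) field_differentiable at (p d)" for p :: "'a point" and d
    by (cases "d = c") auto
  then show "separately_holomorphic UNIV (\<lambda>p :: 'a point. p c)"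
    by (auto simp: separately_holomorphic_def)
qed (use assms in \<open>auto simp: depends_on_def\<close>)

text \<open>Both operands are restricted to a common neighbourhood and to the union of their finite
  coordinate sets; sums, differences and products then differ only in the closure properties of
  \<open>F\<close>.\<close>

lemma regular_at_combine:
  assumes f: "regular_at C f p" and g: "regular_at C g p"
    and cont: "\<And>V. continuous_on V f \<Longrightarrow> continuous_on V g \<Longrightarrow> continuous_on V (\<lambda>q. F (f q) (g q))"
    and diff: "\<And>\<phi> \<psi> x. \<phi> field_differentiable at x \<Longrightarrow> \<psi> field_differentiable at x \<Longrightarrow>
                 (\<lambda>\<zeta>. F (\<phi> \<zeta>) (\<psi> \<zeta>)) field_differentiable at x"
  shows "regular_at C (\<lambda>q. F (f q) (g q)) p"
proof -
  obtain V J where 1: "open V" "p \<in> V" "finite J" "J \<subseteq> coords C" "depends_on V J f"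
    "separately_holomorphic V f" using f by (rule regular_atE)
  obtain W K where 2: "open W" "p \<in> W" "finite K" "K \<subseteq> coords C" "depends_on W K g"
    "separately_holomorphic W g" using g by (rule regular_atE)
  have d: "depends_on (V \<inter> W) (J \<union> K) f" "depends_on (V \<inter> W) (J \<union> K) g"
    by (rule depends_on_mono[OF 1(5)]; blast) (rule depends_on_mono[OF 2(5)]; blast)
  have s: "separately_holomorphic (V \<inter> W) f" "separately_holomorphic (V \<inter> W) g"
    by (rule separately_holomorphic_subset[OF 1(6)]; blast)
       (rule separately_holomorphic_subset[OF 2(6)]; blast)
  show ?thesis
  proof (rule regular_atI[of "V \<inter> W" _ "J \<union> K"])
    show "depends_on (V \<inter> W) (J \<union> K) (\<lambda>q. F (f q) (g q))"
      using d unfolding depends_on_def by metis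
    show "separately_holomorphic (V \<inter> W) (\<lambda>q. F (f q) (g q))"
      using s cont diff unfolding separately_holomorphic_def by blast
  qed (use 1 2 in auto)
qed

lemma regular_at_add: "regular_at C f p \<Longrightarrow> regular_at C g p \<Longrightarrow> regular_at C (\<lambda>q. f q + g q) p"
  by (erule (1) regular_at_combine) (auto intro: continuous_intros derivative_intros)

lemma regular_at_diff: "regular_at C f p \<Longrightarrow> regular_at C g p \<Longrightarrow> regular_at C (\<lambda>q. f q - g q) p"
  by (erule (1) regular_at_combine) (auto intro: continuous_intros derivative_intros)

lemma regular_at_mult: "regular_at C f p \<Longrightarrow> regular_at C g p \<Longrightarrow> regular_at C (\<lambda>q. f q * g q) p"
  by (erule (1) regular_at_combine) (auto intro: continuous_intros derivative_intros)

lemma regular_at_minus: "regular_at C f p \<Longrightarrow> regular_at C (\<lambda>q. - f q) p"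
  using regular_at_diff[OF regular_at_const, of C f p 0] by simp

lemma regular_at_sum:
  "finite A \<Longrightarrow> (\<And>a. a \<in> A \<Longrightarrow> regular_at C (f a) p) \<Longrightarrow> regular_at C (\<lambda>q. \<Sum>a\<in>A. f a q) p"
  by (induction A rule: finite_induct) (auto intro: regular_at_const regular_at_add)

text \<open>The components of the \<open>i\<close>-th total derivative regarded as a vector field.\<close>

primrec D_coeff :: "'w covering \<Rightarrow> ivar \<Rightarrow> 'w coord \<Rightarrow> 'w func" where
  "D_coeff C i (Indep j) p = (if j = i then 1 else 0)"
| "D_coeff C i (Jet \<alpha>) p = p (Jet (add_mset i \<alpha>))"
| "D_coeff C i (Nonlocal w) p = nl_coeff C i w p"

text \<open>The index sets in \<open>total_D\<close> vary with the function and the point. Rewriting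
  the sum over any sufficiently large finite \<open>J\<close> lets total derivatives of several
  functions be compared term by term.\<close>

lemma total_D_eq_sum:
  assumes J: "finite J" "J \<subseteq> coords C" and pd0: "\<And>c. c \<notin> J \<Longrightarrow> pd c f p = 0"
  shows "total_D C i f p = (\<Sum>c\<in>J. D_coeff C i c p * pd c f p)"
proof -
  let ?g = "\<lambda>c. D_coeff C i c p * pd c f p"
  let ?A = "{\<alpha>. pd (Jet \<alpha>) f p \<noteq> 0}" and ?N = "{w \<in> nl_vars C. pd (Nonlocal w) f p \<noteq> 0}"
  have nz: "c \<in> J" if "pd c f p \<noteq> 0" for c
    using pd0 that by blast
  have A: "finite ?A"
    by (rule finite_subset[OF _ finite_vimageI[OF J(1), of Jet]]) (auto simp: inj_def intro: nz)
  have N: "finite ?N"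
    by (rule finite_subset[OF _ finite_vimageI[OF J(1), of Nonlocal]]) (auto simp: inj_def intro: nz)
  let ?K = "{Indep i} \<union> Jet ` ?A \<union> Nonlocal ` ?N"
  have "sum ?g J = sum ?g (J \<union> ?K)"
  proof (rule sum.mono_neutral_left)
    show "\<forall>c\<in>J \<union> ?K - J. ?g c = 0" using pd0 by auto
  qed (use J A N in auto)
  \<comment> \<open>A coordinate of \<open>J\<close> outside \<open>?K\<close> contributes 0:
    another independent variable has coefficient 0, the others have zero partial derivative, and
    \<open>J \<subseteq> coords C\<close> excludes the dummy nonlocal coordinates.\<close>
  also have "\<dots> = sum ?g ?K"
  proof (rule sum.mono_neutral_right)
    show "\<forall>c\<in>J \<union> ?K - ?K. ?g c = 0"
    proof
      fix c assume c: "c \<in> J \<union> ?K - ?K"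
      show "?g c = 0"
      proof (cases c)
        case (Nonlocal w)
        then have "w \<in> nl_vars C" using c J(2) by (auto simp: coords_def)
        then show ?thesis using c Nonlocal by auto
      qed (use c in auto)
    qed
  qed (use J A N in auto)
  also have "\<dots> = sum ?g ({Indep i} \<union> Jet ` ?A) + sum ?g (Nonlocal ` ?N)"
    by (rule sum.union_disjoint) (use A N in auto)
  also have "sum ?g ({Indep i} \<union> Jet ` ?A) = sum ?g {Indep i} + sum ?g (Jet ` ?A)"
    by (rule sum.union_disjoint) (use A in auto)
  also have "sum ?g {Indep i} + sum ?g (Jet ` ?A) + sum ?g (Nonlocal ` ?N) = total_D C i f p"
    by (subst (1 2) sum.reindex) (auto simp: inj_on_def total_D_def jet_D_def)
  finally show ?thesis ..
qed

lemma regular_at_total_D_eq_sum: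
  assumes "open V" "p \<in> V" "finite J" "J \<subseteq> coords C" "depends_on V J f"
  shows "total_D C i f p = (\<Sum>c\<in>J. D_coeff C i c p * pd c f p)"
  using assms by (intro total_D_eq_sum pd_eq_0[of V])

section \<open>Linearity and the Leibniz rule for total derivatives\<close>

lemma field_differentiable_regular_at:
  assumes "regular_at C f p"
  shows "(\<lambda>\<zeta>. f (p(c := \<zeta>))) field_differentiable at (p c)"
  using assms by (auto simp: regular_at_def holomorphic_func_def)

lemma total_D_common_sum:
  assumes "regular_at C f p" "regular_at C g p"
  obtains J where "finite J" "J \<subseteq> coords C" "\<And>c. c \<notin> J \<Longrightarrow> pd c f p = 0" "\<And>c. c \<notin> J \<Longrightarrow> pd c g p = 0"
proof -
  obtain V J where 1: "open V" "p \<in> V" "finite J" "J \<subseteq> coords C" "depends_on V J f"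
    using assms(1) by (rule regular_atE)
  obtain W K where 2: "open W" "p \<in> W" "finite K" "K \<subseteq> coords C" "depends_on W K g"
    using assms(2) by (rule regular_atE)
  show ?thesis
    by (rule that[of "J \<union> K"]) (use 1 2 in \<open>auto intro: pd_eq_0\<close>)
qed

lemma total_D_add:
  assumes f: "regular_at C f p" and g: "regular_at C g p"
  shows "total_D C i (\<lambda>q. f q + g q) p = total_D C i f p + total_D C i g p"
proof -
  obtain J where J: "finite J" "J \<subseteq> coords C" "\<And>c. c \<notin> J \<Longrightarrow> pd c f p = 0" "\<And>c. c \<notin> J \<Longrightarrow> pd c g p = 0"
    using f g by (rule total_D_common_sum) blast
  have pd: "pd c (\<lambda>q. f q + g q) p = pd c f p + pd c g p" for c
    unfolding pd_def by (intro deriv_add field_differentiable_regular_at[OF f] field_differentiable_regular_at[OF g])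
  show ?thesis
    using J by (simp add: total_D_eq_sum[OF J(1,2)] pd sum.distrib distrib_left)
qed

lemma total_D_diff:
  assumes f: "regular_at C f p" and g: "regular_at C g p"
  shows "total_D C i (\<lambda>q. f q - g q) p = total_D C i f p - total_D C i g p"
proof -
  obtain J where J: "finite J" "J \<subseteq> coords C" "\<And>c. c \<notin> J \<Longrightarrow> pd c f p = 0" "\<And>c. c \<notin> J \<Longrightarrow> pd c g p = 0"
    using f g by (rule total_D_common_sum) blast
  have pd: "pd c (\<lambda>q. f q - g q) p = pd c f p - pd c g p" for c
    unfolding pd_def by (intro deriv_diff field_differentiable_regular_at[OF f] field_differentiable_regular_at[OF g])
  show ?thesis
    using J by (simp add: total_D_eq_sum[OF J(1,2)] pd sum_subtractf right_diff_distrib)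
qed

lemma total_D_mult:
  assumes f: "regular_at C f p" and g: "regular_at C g p"
  shows "total_D C i (\<lambda>q. f q * g q) p = f p * total_D C i g p + total_D C i f p * g p"
proof -
  obtain J where J: "finite J" "J \<subseteq> coords C" "\<And>c. c \<notin> J \<Longrightarrow> pd c f p = 0" "\<And>c. c \<notin> J \<Longrightarrow> pd c g p = 0"
    using f g by (rule total_D_common_sum) blast
  have pd: "pd c (\<lambda>q. f q * g q) p = f p * pd c g p + pd c f p * g p" for c
    unfolding pd_def by (subst deriv_mult) (auto intro: field_differentiable_regular_at[OF f] field_differentiable_regular_at[OF g])
  show ?thesis
    using J by (simp add: total_D_eq_sum[OF J(1,2)] pd sum.distrib sum_distrib_left sum_distrib_right
        algebra_simps)
qed

lemma total_D_const [simp]: "total_D C i (\<lambda>q. a) p = 0"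
  by (subst total_D_eq_sum[of "{}"]) auto

lemma total_D_minus:
  assumes "regular_at C f p"
  shows "total_D C i (\<lambda>q. - f q) p = - total_D C i f p"
  using total_D_diff[OF regular_at_const assms, of i 0] by simp

lemma total_D_jet: "total_D C i (\<lambda>q. q (Jet \<alpha>)) p = p (Jet (add_mset i \<alpha>))"
proof -
  have pd: "pd c (\<lambda>q. q (Jet \<alpha>)) p = (if c = Jet \<alpha> then 1 else 0)" for c
    by (simp add: pd_def)
  show ?thesis
    by (subst total_D_eq_sum[of "{Jet \<alpha>}"]) (auto simp: pd coords_def)
qed

subsection \<open>Polynomials in the jet coordinates\<close>

text \<open>A syntax for polynomials makes total differentiation structural and exposes the finitely
  many jets that occur, on which the recursion in \<open>solve\<close> relies. No constants are
  needed to write the equation or its derivatives.\<close>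

datatype jexp = JVar "ivar multiset" | JPlus jexp jexp | JTimes jexp jexp | JMinus jexp

primrec jeval :: "jexp \<Rightarrow> (ivar multiset \<Rightarrow> complex) \<Rightarrow> complex" where
  "jeval (JVar \<alpha>) P = P \<alpha>"
| "jeval (JPlus a b) P = jeval a P + jeval b P"
| "jeval (JTimes a b) P = jeval a P * jeval b P"
| "jeval (JMinus a) P = - jeval a P"

text \<open>The differential of the polynomial at \<open>P\<close>, applied to the tangent vector
  \<open>v\<close>.\<close>

primrec jdir :: "jexp \<Rightarrow> (ivar multiset \<Rightarrow> complex) \<Rightarrow> (ivar multiset \<Rightarrow> complex) \<Rightarrow> complex" where
  "jdir (JVar \<alpha>) P v = v \<alpha>"
| "jdir (JPlus a b) P v = jdir a P v + jdir b P v"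
| "jdir (JTimes a b) P v = jeval a P * jdir b P v + jdir a P v * jeval b P"
| "jdir (JMinus a) P v = - jdir a P v"

primrec jder :: "ivar \<Rightarrow> jexp \<Rightarrow> jexp" where
  "jder i (JVar \<alpha>) = JVar (add_mset i \<alpha>)"
| "jder i (JPlus a b) = JPlus (jder i a) (jder i b)"
| "jder i (JTimes a b) = JPlus (JTimes a (jder i b)) (JTimes (jder i a) b)"
| "jder i (JMinus a) = JMinus (jder i a)"

primrec jets :: "jexp \<Rightarrow> ivar multiset set" where
  "jets (JVar \<alpha>) = {\<alpha>}"
| "jets (JPlus a b) = jets a \<union> jets b"
| "jets (JTimes a b) = jets a \<union> jets b"
| "jets (JMinus a) = jets a"

abbreviation jfun :: "jexp \<Rightarrow> 'w func" where
  "jfun e \<equiv> (\<lambda>p. jeval e (\<lambda>\<alpha>. p (Jet \<alpha>)))"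

lemma jets_jder: "jets (jder i e) \<subseteq> jets e \<union> add_mset i ` jets e"
  by (induction e) auto

text \<open>As a congruence rule for function definitions it confines the recursive calls of
  \<open>solve\<close> to the jets of the evaluated expression.\<close>

lemma jeval_cong [fundef_cong]:
  "e = e' \<Longrightarrow> (\<And>\<alpha>. \<alpha> \<in> jets e' \<Longrightarrow> P \<alpha> = Q \<alpha>) \<Longrightarrow> jeval e P = jeval e' Q"
  by (induction e arbitrary: e') auto

lemma jeval_jder: "jeval (jder i e) P = jdir e P (\<lambda>\<alpha>. P (add_mset i \<alpha>))"
  by (induction e) auto

lemma has_field_derivative_jeval:
  assumes "\<And>\<alpha>. \<alpha> \<in> jets e \<Longrightarrow> ((\<lambda>\<zeta>. \<gamma> \<zeta> \<alpha>) has_field_derivative v \<alpha>) (at x)"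
  shows "((\<lambda>\<zeta>. jeval e (\<gamma> \<zeta>)) has_field_derivative jdir e (\<gamma> x) v) (at x)"
  using assms
proof (induction e)
  case (JTimes a b)
  then have "((\<lambda>\<zeta>. jeval a (\<gamma> \<zeta>)) has_field_derivative jdir a (\<gamma> x) v) (at x)"
    "((\<lambda>\<zeta>. jeval b (\<gamma> \<zeta>)) has_field_derivative jdir b (\<gamma> x) v) (at x)"
    by auto
  from DERIV_mult[OF this] show ?case by (simp add: algebra_simps)
qed (auto intro: derivative_intros)

lemma jeval_jder_commute: "jeval (jder i (jder j e)) P = jeval (jder j (jder i e)) P"
  by (induction e) (simp_all add: add_mset_commute algebra_simps)

lemma regular_at_jfun: "regular_at C (jfun e) p"
  by (induction e)
     (auto intro: regular_at_add regular_at_mult regular_at_minus regular_at_coordinate simp: coords_def)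

lemma total_D_jfun: "total_D C i (jfun e) = jfun (jder i e)"
proof
  fix p
  show "total_D C i (jfun e) p = jfun (jder i e) p"
    by (induction e)
       (simp_all add: total_D_jet total_D_add total_D_mult total_D_minus regular_at_jfun)
qed

text \<open>On a covering without nonlocal variables \<open>total_D\<close> reduces to
  \<open>jet_D\<close>.\<close>

lemma jet_D_jfun: "jet_D i (jfun e) = jfun (jder i e)"
  using total_D_jfun[of "\<lparr>nl_vars = {}, cov_dom = UNIV, nl_coeff = (\<lambda>i w p. 0)\<rparr>" i e]
  by (simp add: total_D_def fun_eq_iff)

text \<open>Although \<open>jder\<close> works on syntax, it computes \<open>jet_D\<close> of the
  function represented, and this sees only the values.\<close>

lemma jeval_jder_cong:
  assumes "\<And>P. jeval e P = jeval e' P"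
  shows "jeval (jder i e) P = jeval (jder i e') P"
proof -
  have "(jfun e :: unit func) = jfun e'" using assms by auto
  then have "(jfun (jder i e) :: unit func) = jfun (jder i e')"
    by (simp only: jet_D_jfun[symmetric])
  \<comment> \<open>Any assignment \<open>P\<close> of jets is the jet part of a point whose other
    coordinates are 0.\<close>
  from fun_cong[OF this, of "case_coord (\<lambda>_. 0) P (\<lambda>_. 0)"] show ?thesis by simp
qed

subsection \<open>The equation and its consequences\<close>

definition eqn_rest :: jexp where
  "eqn_rest = JPlus (JMinus (JTimes (JVar {#Z#}) (JVar {#S, T#})))
     (JPlus (JMinus (JTimes (JVar {#S#}) (JVar {#X, Y#})))
     (JPlus (JTimes (JVar {#Y#}) (JVar {#S, X#}))
     (JPlus (JMinus (JTimes (JVar {#Y#}) (JVar {#R, Z#})))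
        (JTimes (JVar {#Z#}) (JVar {#R, Y#})))))"

definition eqn_jexp :: jexp where
  "eqn_jexp = JPlus (JTimes (JVar {#S#}) (JVar {#Z, T#})) eqn_rest"

primrec jders :: "ivar list \<Rightarrow> jexp \<Rightarrow> jexp" where
  "jders [] e = e"
| "jders (i # is) e = jder i (jders is e)"

lemma eqn_eq_jfun: "eqn = jfun eqn_jexp"
  by (simp add: fun_eq_iff eqn_def u_def eqn_jexp_def eqn_rest_def)

lemma jders_consequence: "jfun (jders is eqn_jexp) \<in> consequences"
proof (induction "is")
  case Nil
  show ?case using consequences.intros(1) by (simp add: eqn_eq_jfun)
next
  case (Cons i "is")
  from consequences.intros(2)[OF this, of i] show ?case by (simp add: jet_D_jfun)
qed

lemma consequences_eq: "(consequences :: 'w func set) = range (\<lambda>is. jfun (jders is eqn_jexp))"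
proof
  show "(consequences :: 'w func set) \<subseteq> range (\<lambda>is. jfun (jders is eqn_jexp))"
  proof
    fix G :: "'w func"
    assume "G \<in> consequences"
    then show "G \<in> range (\<lambda>is. jfun (jders is eqn_jexp))"
    proof induction
      case 1
      show ?case by (rule range_eqI[of _ _ "[]"]) (simp add: eqn_eq_jfun)
    next
      case (2 G i)
      then obtain "is" where "G = jfun (jders is eqn_jexp)" by blast
      then show ?case by (intro range_eqI[of _ _ "i # is"]) (simp add: jet_D_jfun)
    qed
  qed
qed (use jders_consequence in blast)

lemma equation_manifold_iff:
  "p \<in> equation_manifold \<longleftrightarrow>
     (\<forall>is. jfun (jders is eqn_jexp) p = 0) \<and> p (Jet {#S#}) \<noteq> 0"
  by (auto simp: equation_manifold_def consequences_eq u_def)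

lemma jeval_jder_jders: "jeval (jder i (jders is e)) P = jeval (jders is (jder i e)) P"
proof (induction "is" arbitrary: P)
  case (Cons j "is")
  have "jeval (jder i (jders (j # is) e)) P = jeval (jder j (jder i (jders is e))) P"
    by (simp add: jeval_jder_commute)
  also have "\<dots> = jeval (jder j (jders is (jder i e))) P"
    by (rule jeval_jder_cong) (rule Cons.IH)
  finally show ?case by simp
qed simp

lemma jders_append: "jders (is @ js) e = jders is (jders js e)"
  by (induction "is") auto

text \<open>Iterated derivatives commute in value, though not as expressions, so each multi-index
  gives only one equation. This justifies the choice of an order in \<open>word\<close>.\<close>

lemma jeval_jders_mset:
  assumes "mset is = mset js"
  shows "jeval (jders is e) P = jeval (jders js e) P"
  using assms
proof (induction "is" arbitrary: js P)
  case (Cons i "is")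
  then have "i \<in> set js" by (metis list.set_intros(1) mset_eq_setD)
  then obtain as bs where js: "js = as @ i # bs" by (meson split_list)
  have "mset is = mset (as @ bs)" using Cons.prems js by simp
  then have IH: "jeval (jders is e) P = jeval (jders (as @ bs) e) P" for P by (rule Cons.IH)
  have "jeval (jders (i # is) e) P = jeval (jder i (jders (as @ bs) e)) P"
    by (simp add: jeval_jder_cong[OF IH])
  also have "\<dots> = jeval (jders as (jder i (jders bs e))) P"
    by (simp add: jders_append jeval_jder_jders)
  finally show ?case by (simp add: js jders_append)
qed simp

text \<open>A derivative \<open>u\<^sub>z\<^sub>t\<^sub>\<alpha>\<close> is strictly heavier than all the other jets in the corresponding
  derivative of the equation.\<close>

definition weight :: "ivar multiset \<Rightarrow> nat" where
  "weight \<alpha> = size \<alpha> + count \<alpha> Z + count \<alpha> T"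

text \<open>The derivative of the equation without its leading product. Differentiating that product
  also yields \<open>u\<^sub>s\<^sub>i\<close> times the previous leading jet, which joins the lower
  part.\<close>

primrec eqn_lower :: "ivar list \<Rightarrow> jexp" where
  "eqn_lower [] = eqn_rest"
| "eqn_lower (i # is) = JPlus (jder i (eqn_lower is)) (JTimes (JVar {#S, i#}) (JVar ({#Z, T#} + mset is)))"

definition eqn_leading :: "ivar list \<Rightarrow> jexp" where
  "eqn_leading is = JPlus (JTimes (JVar {#S#}) (JVar ({#Z, T#} + mset is))) (eqn_lower is)"

lemma jeval_jders_eqn: "jeval (jders is eqn_jexp) P = jeval (eqn_leading is) P"
proof (induction "is" arbitrary: P)
  case Nil
  show ?case by (simp add: eqn_jexp_def eqn_leading_def)
next
  case (Cons i "is")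
  have "jeval (jders (i # is) eqn_jexp) P = jeval (jder i (eqn_leading is)) P"
    using jeval_jder_cong[OF Cons.IH] by simp
  then show ?case by (simp add: eqn_leading_def add_mset_commute)
qed

text \<open>Counting \<open>Z\<close> and \<open>T\<close> twice gives
  \<open>u\<^sub>z\<^sub>t\<close> weight 4 and every other jet of the equation weight at most 3.
  Differentiation by \<open>i\<close> raises the leading weight by the weight of \<open>i\<close>,
  and no other jet by more; the two jets of the additional product are light enough as well.\<close>

lemma weight_jets_eqn_lower: "\<beta> \<in> jets (eqn_lower is) \<Longrightarrow> weight \<beta> < weight ({#Z, T#} + mset is)"
proof (induction "is" arbitrary: \<beta>)
  case Nil
  then show ?case by (auto simp: eqn_rest_def weight_def)
next
  case (Cons i "is")
  have w: "weight (add_mset i \<alpha>) = weight \<alpha> + weight {#i#}" for \<alpha> by (simp add: weight_def)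
  have i: "weight {#i#} > 0" "weight {#S, i#} = 1 + weight {#i#}" by (simp_all add: weight_def)
  have zt: "weight ({#Z, T#} + mset is) \<ge> 4" by (simp add: weight_def)
  have e: "weight ({#Z, T#} + mset (i # is)) = weight ({#Z, T#} + mset is) + weight {#i#}"
    by (simp add: weight_def)
  consider "\<beta> \<in> jets (jder i (eqn_lower is))" | "\<beta> = {#S, i#}" | "\<beta> = {#Z, T#} + mset is"
    using Cons.prems by auto
  then show ?case
  proof cases
    case 1
    then consider "\<beta> \<in> jets (eqn_lower is)"
      | \<alpha> where "\<alpha> \<in> jets (eqn_lower is)" "\<beta> = add_mset i \<alpha>"
      using jets_jder by blast
    then show ?thesis
    proof cases
      case 1
      from Cons.IH[OF this] show ?thesis unfolding e by linarith
    next
      case (2 \<alpha>)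
      from Cons.IH[OF 2(1)] show ?thesis unfolding e 2(2) w[of \<alpha>] by linarith
    qed
  next
    case 2
    then show ?thesis using i zt unfolding e by simp
  next
    case 3
    then show ?thesis using i unfolding e by simp
  qed
qed

subsection \<open>Solving the equation for the derivatives containing \<open>z\<close> and \<open>t\<close>\<close>

definition word :: "ivar multiset \<Rightarrow> ivar list" where
  "word \<alpha> = (SOME is. mset is = \<alpha>)"

lemma mset_word [simp]: "mset (word \<alpha>) = \<alpha>"
  unfolding word_def by (rule someI_ex) (rule ex_mset)

lemma add_ZT_diff:
  assumes "{#Z, T#} \<subseteq># \<beta>"
  shows "add_mset Z (add_mset T (\<beta> - {#Z, T#})) = \<beta>"
  using subset_mset.add_diff_inverse[OF assms] by simp

text \<open>Jets without both \<open>Z\<close> and \<open>T\<close> are free parameters; the others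
  are computed from derivatives of the equation by recursion on the weight, whatever their values in
  \<open>P\<close>. For \<open>P {#S#} = 0\<close> the quotient is 0 by convention, but the solution
  property is claimed only for \<open>P {#S#} \<noteq> 0\<close>.\<close>

function solve :: "(ivar multiset \<Rightarrow> complex) \<Rightarrow> ivar multiset \<Rightarrow> complex" where
  "solve P \<beta> = (if {#Z, T#} \<subseteq># \<beta>
     then - jeval (eqn_lower (word (\<beta> - {#Z, T#}))) (\<lambda>\<alpha>. solve P \<alpha>) / P {#S#}
     else P \<beta>)"
  by pat_completeness auto
termination
proof (relation "inv_image less_than (\<lambda>(P, \<beta>). weight \<beta>)")
  fix P :: "ivar multiset \<Rightarrow> complex" and \<beta> \<alpha>
  assume "{#Z, T#} \<subseteq># \<beta>" "\<alpha> \<in> jets (eqn_lower (word (\<beta> - {#Z, T#})))"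
  then show "((P, \<alpha>), (P, \<beta>)) \<in> inv_image less_than (\<lambda>(P, \<beta>). weight \<beta>)"
    using weight_jets_eqn_lower[of \<alpha> "word (\<beta> - {#Z, T#})"] by (simp add: add_ZT_diff)
qed simp

declare solve.simps [simp del]

lemma solve_S [simp]: "solve P {#S#} = P {#S#}"
  by (subst solve.simps) (auto dest: mset_subset_eqD[of _ _ Z])

text \<open>By construction the equation holds for the order of differentiation chosen by
  \<open>word\<close>; the other orders have the same value.\<close>

lemma solve_solves:
  assumes "P {#S#} \<noteq> 0"
  shows "jeval (jders is eqn_jexp) (solve P) = 0"
proof -
  let ?w = "word (mset is)"
  have "solve P ({#Z, T#} + mset is) = - jeval (eqn_lower ?w) (solve P) / P {#S#}"
    by (subst solve.simps) simp
  then have "jeval (eqn_leading ?w) (solve P) = 0"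
    using assms by (simp add: eqn_leading_def)
  moreover have "jeval (jders is eqn_jexp) (solve P) = jeval (jders ?w eqn_jexp) (solve P)"
    by (rule jeval_jders_mset) simp
  ultimately show ?thesis by (simp only: jeval_jders_eqn)
qed

lemma principal_eq:
  assumes sol: "\<And>is. jeval (jders is eqn_jexp) P = 0" and S: "P {#S#} \<noteq> 0" and "{#Z, T#} \<subseteq># \<beta>"
  shows "P \<beta> = - jeval (eqn_lower (word (\<beta> - {#Z, T#}))) P / P {#S#}"
proof -
  have "{#Z, T#} + (\<beta> - {#Z, T#}) = \<beta>" using assms(3) by (simp add: add_ZT_diff)
  then have "P {#S#} * P \<beta> + jeval (eqn_lower (word (\<beta> - {#Z, T#}))) P = 0"
    using sol[of "word (\<beta> - {#Z, T#})"] by (simp add: jeval_jders_eqn eqn_leading_def)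
  then show ?thesis using S by (simp add: field_simps eq_neg_iff_add_eq_0)
qed

lemma weight_eqn_lower_word:
  assumes "{#Z, T#} \<subseteq># \<beta>" "\<alpha> \<in> jets (eqn_lower (word (\<beta> - {#Z, T#})))"
  shows "weight \<alpha> < weight \<beta>"
  using weight_jets_eqn_lower[OF assms(2)] assms(1) by (simp add: add_ZT_diff)

text \<open>On the manifold the jets containing \<open>Z\<close> and \<open>T\<close> obey the
  recursion that defines \<open>solve\<close>, so induction on the weight gives uniqueness.\<close>

lemma solve_eq:
  assumes sol: "\<And>is. jeval (jders is eqn_jexp) P = 0" and S: "P {#S#} \<noteq> 0"
  shows "solve P \<beta> = P \<beta>"
proof (induction "weight \<beta>" arbitrary: \<beta> rule: less_induct)
  case less
  show ?case
  proof (cases "{#Z, T#} \<subseteq># \<beta>")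
    case True
    have "jeval (eqn_lower (word (\<beta> - {#Z, T#}))) (solve P) = jeval (eqn_lower (word (\<beta> - {#Z, T#}))) P"
      by (rule jeval_cong[OF refl]) (use less weight_eqn_lower_word[OF True] in blast)
    then show ?thesis
      using principal_eq[OF sol S True] True by (subst solve.simps) simp
  next
    case False
    then show ?thesis by (subst solve.simps) simp
  qed
qed

text \<open>Free jets have velocity \<open>v\<close> by construction. For the others,
  differentiating the recursion gives the linear equation that the next derivative of the equation
  imposes on \<open>v \<beta>\<close>; it has one solution since
  \<open>P {#S#} \<noteq> 0\<close>.\<close>

lemma has_field_derivative_solve:
  fixes P :: "ivar multiset \<Rightarrow> complex" and i :: ivar
  assumes sol: "\<And>is. jeval (jders is eqn_jexp) P = 0" and S: "P {#S#} \<noteq> 0"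
  defines "v \<equiv> \<lambda>\<alpha>. P (add_mset i \<alpha>)"
  shows "((\<lambda>\<zeta>. solve (\<lambda>\<alpha>. P \<alpha> + \<zeta> * v \<alpha>) \<beta>) has_field_derivative v \<beta>) (at 0)"
proof (induction "weight \<beta>" arbitrary: \<beta> rule: less_induct)
  case less
  let ?P = "\<lambda>\<zeta> \<alpha>. P \<alpha> + \<zeta> * v \<alpha>"
  have lin: "((\<lambda>\<zeta>. ?P \<zeta> \<alpha>) has_field_derivative v \<alpha>) (at 0)" for \<alpha>
    by (auto intro!: derivative_eq_intros)
  show ?case
  proof (cases "{#Z, T#} \<subseteq># \<beta>")
    case True
    let ?w = "word (\<beta> - {#Z, T#})"
    have \<beta>: "{#Z, T#} + (\<beta> - {#Z, T#}) = \<beta>" using True by (simp add: add_ZT_diff)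
    have 0: "solve (?P 0) = P" using solve_eq[OF sol S] by (simp add: fun_eq_iff)
    have "((\<lambda>\<zeta>. jeval (eqn_lower ?w) (solve (?P \<zeta>))) has_field_derivative
            jdir (eqn_lower ?w) (solve (?P 0)) v) (at 0)"
      by (rule has_field_derivative_jeval) (use less weight_eqn_lower_word[OF True] in blast)
    from DERIV_divide[OF DERIV_minus[OF this] lin[of "{#S#}"]]
    have der: "((\<lambda>\<zeta>. - jeval (eqn_lower ?w) (solve (?P \<zeta>)) / ?P \<zeta> {#S#}) has_field_derivative
        (- jdir (eqn_lower ?w) P v * P {#S#} + jeval (eqn_lower ?w) P * v {#S#}) /
          (P {#S#} * P {#S#})) (at 0)"
      using S unfolding 0 by simp
    \<comment> \<open>A total derivative is the differential in direction \<open>v\<close>, so the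
      equation differentiated once more by \<open>i\<close> is linear in \<open>v\<close>.\<close>
    have "jeval (jders (i # ?w) eqn_jexp) P = jdir (eqn_leading ?w) P v"
      using jeval_jder_cong[OF jeval_jders_eqn] by (simp add: jeval_jder v_def)
    then have lin': "P {#S#} * v \<beta> + v {#S#} * P \<beta> + jdir (eqn_lower ?w) P v = 0"
      using sol[of "i # ?w"] \<beta> by (simp add: eqn_leading_def)
    have "jeval (eqn_lower ?w) P = - P {#S#} * P \<beta>"
      using principal_eq[OF sol S True] S by (simp add: field_simps)
    with lin' have "- jdir (eqn_lower ?w) P v * P {#S#} + jeval (eqn_lower ?w) P * v {#S#} =
        v \<beta> * (P {#S#} * P {#S#})"
      by algebra
    then have "(- jdir (eqn_lower ?w) P v * P {#S#} + jeval (eqn_lower ?w) P * v {#S#}) /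
          (P {#S#} * P {#S#}) = v \<beta>"
      using S by simp
    moreover have "solve (?P \<zeta>) \<beta> = - jeval (eqn_lower ?w) (solve (?P \<zeta>)) / ?P \<zeta> {#S#}" for \<zeta>
      using True by (subst solve.simps) simp
    ultimately show ?thesis using der by simp
  next
    case False
    then have "solve (?P \<zeta>) \<beta> = ?P \<zeta> \<beta>" for \<zeta> by (subst solve.simps) simp
    then show ?thesis using lin by simp
  qed
qed

subsection \<open>Generic identities\<close>

text \<open>Density in local form: every open set meeting the manifold can be shrunk to one that
  still meets it and on which \<open>P\<close> holds. Several generic properties are then combined
  by shrinking repeatedly.\<close>

lemma generically_iff:
  "generically C P \<longleftrightarrow>
     (\<forall>W. open W \<longrightarrow> W \<inter> manifold C \<noteq> {} \<longrightarrow>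
        (\<exists>V. open V \<and> V \<subseteq> W \<and> V \<inter> manifold C \<noteq> {} \<and> (\<forall>p \<in> V \<inter> manifold C. P p)))"
    (is "_ \<longleftrightarrow> ?R")
proof
  assume "generically C P"
  then obtain V where V: "open V" "manifold C \<subseteq> closure (V \<inter> manifold C)"
    "\<And>p. p \<in> V \<inter> manifold C \<Longrightarrow> P p"
    by (auto simp: generically_def)
  show ?R
  proof (intro allI impI)
    fix W :: "'a point set" assume W: "open W" "W \<inter> manifold C \<noteq> {}"
    then have "W \<inter> closure (V \<inter> manifold C) \<noteq> {}" using V(2) by blast
    then have "W \<inter> (V \<inter> manifold C) \<noteq> {}" using open_Int_closure_eq_empty[OF W(1)] by blast
    then show "\<exists>V. open V \<and> V \<subseteq> W \<and> V \<inter> manifold C \<noteq> {} \<and> (\<forall>p \<in> V \<inter> manifold C. P p)"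
      using V(1,3) W(1) by (intro exI[of _ "W \<inter> V"]) auto
  qed
next
  assume R: ?R
  \<comment> \<open>The largest open set on whose part of the manifold \<open>P\<close>
    holds.\<close>
  let ?V = "\<Union>{V. open V \<and> (\<forall>p \<in> V \<inter> manifold C. P p)}"
  have "manifold C \<subseteq> closure (?V \<inter> manifold C)"
  proof
    fix p assume p: "p \<in> manifold C"
    show "p \<in> closure (?V \<inter> manifold C)"
      unfolding closure_iff_nhds_not_empty
    proof (intro allI impI)
      fix A W :: "'a point set" assume W: "W \<subseteq> A" "open W" "p \<in> W"
      then obtain V where "open V" "V \<subseteq> W" "V \<inter> manifold C \<noteq> {}" "\<forall>p \<in> V \<inter> manifold C. P p"
        using R p by (metis IntI empty_iff)
      then show "(?V \<inter> manifold C) \<inter> A \<noteq> {}" using W(1) by blast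
    qed
  qed
  then show "generically C P"
    unfolding generically_def by (intro exI[of _ ?V]) auto
qed

lemma generically_mono:
  assumes "generically C P" "\<And>p. p \<in> manifold C \<Longrightarrow> P p \<Longrightarrow> Q p"
  shows "generically C Q"
  using assms unfolding generically_def by (metis IntD2)

lemma generically_True: "generically C (\<lambda>p. True)"
  unfolding generically_def by (intro exI[of _ UNIV]) (auto simp: closure_subset)

lemma generically_conj:
  assumes P: "generically C P" and Q: "generically C Q"
  shows "generically C (\<lambda>p. P p \<and> Q p)"
  unfolding generically_iff
proof (intro allI impI)
  fix W :: "'a point set" assume "open W" "W \<inter> manifold C \<noteq> {}"
  then obtain V where V: "open V" "V \<subseteq> W" "V \<inter> manifold C \<noteq> {}" "\<forall>p \<in> V \<inter> manifold C. P p"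
    using P unfolding generically_iff by metis
  then obtain V' where "open V'" "V' \<subseteq> V" "V' \<inter> manifold C \<noteq> {}" "\<forall>p \<in> V' \<inter> manifold C. Q p"
    using Q unfolding generically_iff by metis
  then show "\<exists>V. open V \<and> V \<subseteq> W \<and> V \<inter> manifold C \<noteq> {} \<and> (\<forall>p \<in> V \<inter> manifold C. P p \<and> Q p)"
    using V by (intro exI[of _ V']) blast
qed

lemma generically_ball:
  assumes "finite A" "\<And>a. a \<in> A \<Longrightarrow> generically C (P a)"
  shows "generically C (\<lambda>p. \<forall>a\<in>A. P a p)"
  using assms
proof (induction A rule: finite_induct)
  case empty
  then show ?case using generically_True by simp
next
  case (insert a A)
  then have "generically C (\<lambda>p. P a p \<and> (\<forall>a\<in>A. P a p))"
    by (intro generically_conj) auto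
  then show ?case by simp
qed

section \<open>Generic regularity of meromorphic functions and their total derivatives\<close>

lemma meromorphic_funcE:
  assumes "meromorphic_func C f" "p \<in> manifold C"
  obtains V g h where "open V" "p \<in> V" "holomorphic_func C V g" "holomorphic_func C V h"
    "V \<inter> manifold C \<subseteq> closure {q \<in> V \<inter> manifold C. h q \<noteq> 0}"
    "\<forall>q \<in> V. h q \<noteq> 0 \<longrightarrow> f q = g q / h q"
  using bspec[OF assms(1)[unfolded meromorphic_func_def] assms(2)]
  by (elim exE conjE) (rule that)

text \<open>Off the zeros of the local denominator \<open>f\<close> is a holomorphic quotient on an
  open set, and those points are dense in the manifold by definition.\<close>

lemma generically_regular_meromorphic:
  assumes "meromorphic_func C f"
  shows "generically C (regular_at C f)"
  unfolding generically_iff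
proof (intro allI impI)
  fix W :: "'a point set" assume W: "open W" "W \<inter> manifold C \<noteq> {}"
  then obtain p where p: "p \<in> W" "p \<in> manifold C" by blast
  obtain V g h where V: "open V" "p \<in> V" "holomorphic_func C V g" "holomorphic_func C V h"
    "V \<inter> manifold C \<subseteq> closure {q \<in> V \<inter> manifold C. h q \<noteq> 0}"
    "\<forall>q \<in> V. h q \<noteq> 0 \<longrightarrow> f q = g q / h q"
    using assms p(2) by (rule meromorphic_funcE)
  obtain J where g: "finite J" "J \<subseteq> coords C" "depends_on V J g" "separately_holomorphic V g"
    using V(3) by (auto simp: holomorphic_func_iff)
  obtain K where h: "finite K" "K \<subseteq> coords C" "depends_on V K h" "separately_holomorphic V h"
    using V(4) by (auto simp: holomorphic_func_iff)
  let ?V = "{q \<in> V. h q \<noteq> 0}"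
  have "?V = V \<inter> h -` (- {0})" by auto
  then have oV: "open ?V"
    using h(4) V(1) continuous_open_preimage[of V h "- {0}"]
    by (simp add: separately_holomorphic_def open_Compl)
  have "p \<in> W \<inter> V" "p \<in> closure {q \<in> V \<inter> manifold C. h q \<noteq> 0}" using p V(2,5) by auto
  then have ne: "W \<inter> V \<inter> {q \<in> V \<inter> manifold C. h q \<noteq> 0} \<noteq> {}"
    using open_Int_closure_eq_empty[of "W \<inter> V"] W(1) V(1) by blast
  have "regular_at C f q" if q: "q \<in> ?V" for q
  proof (rule regular_at_cong[OF oV q])
    show "regular_at C (\<lambda>q. g q / h q) q"
    proof (rule regular_atI[OF oV q, of "J \<union> K"])
      show "depends_on ?V (J \<union> K) (\<lambda>q. g q / h q)"
        unfolding depends_on_def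
      proof (intro ballI impI)
        fix x y assume "x \<in> ?V" "y \<in> ?V" "\<forall>c\<in>J \<union> K. x c = y c"
        then have "g x = g y" "h x = h y"
          using g(3) h(3) unfolding depends_on_def by blast+
        then show "g x / h x = g y / h y" by simp
      qed
      have "separately_holomorphic ?V g" "separately_holomorphic ?V h"
        using g(4) h(4) by (auto intro: separately_holomorphic_subset)
      then show "separately_holomorphic ?V (\<lambda>q. g q / h q)"
        unfolding separately_holomorphic_def
        by (auto intro!: continuous_intros field_differentiable_divide)
    qed (use g h in auto)
  qed (simp add: V(6))
  then show "\<exists>V. open V \<and> V \<subseteq> W \<and> V \<inter> manifold C \<noteq> {} \<and> (\<forall>p \<in> V \<inter> manifold C. regular_at C f p)"
    using oV W(1) ne by (intro exI[of _ "W \<inter> ?V"]) (auto simp: open_Int)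
qed

text \<open>Near a regular point of \<open>f\<close> the total derivative is a fixed finite sum.
  Only finitely many coefficients \<open>nl_coeff\<close> enter, and they are simultaneously regular
  on a dense open part of the manifold.\<close>

lemma generically_regular_total_D:
  assumes cov: "differential_covering C" and f: "generically C (regular_at C f)"
  shows "generically C (regular_at C (total_D C i f))"
  unfolding generically_iff
proof (intro allI impI)
  fix W :: "'a point set" assume "open W" "W \<inter> manifold C \<noteq> {}"
  then obtain W1 where W1: "open W1" "W1 \<subseteq> W" "W1 \<inter> manifold C \<noteq> {}"
    "\<forall>p \<in> W1 \<inter> manifold C. regular_at C f p"
    using f unfolding generically_iff by metis
  then obtain p where p: "p \<in> W1" "p \<in> manifold C" "regular_at C f p" by blast
  obtain V J where V: "open V" "p \<in> V" and J: "finite J" "J \<subseteq> coords C" "depends_on V J f"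
    and hol: "separately_holomorphic V f" using p(3) by (rule regular_atE)
  let ?N = "{w. Nonlocal w \<in> J}"
  have "finite ?N"
    using finite_vimageI[OF J(1), of Nonlocal] by (simp add: inj_def vimage_def)
  moreover have "generically C (regular_at C (nl_coeff C i w))" if "w \<in> ?N" for w
  proof -
    have "w \<in> nl_vars C" using J(2) that by (auto simp: coords_def)
    then show ?thesis
      using cov by (auto simp: differential_covering_def intro: generically_regular_meromorphic)
  qed
  ultimately have "generically C (\<lambda>p. \<forall>w\<in>?N. regular_at C (nl_coeff C i w) p)"
    by (rule generically_ball)
  moreover have "open (W1 \<inter> V)" "(W1 \<inter> V) \<inter> manifold C \<noteq> {}" using W1 V p by auto
  ultimately obtain W2 where W2: "open W2" "W2 \<subseteq> W1 \<inter> V" "W2 \<inter> manifold C \<noteq> {}"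
    "\<forall>p \<in> W2 \<inter> manifold C. \<forall>w\<in>?N. regular_at C (nl_coeff C i w) p"
    unfolding generically_iff by metis
  have "regular_at C (total_D C i f) q" if q: "q \<in> W2 \<inter> manifold C" for q
  proof (rule regular_at_cong[OF V(1)])
    show "q \<in> V" using q W2 by blast
    show "(\<Sum>c\<in>J. D_coeff C i c q' * pd c f q') = total_D C i f q'" if "q' \<in> V" for q'
      using regular_at_total_D_eq_sum[OF V(1) that J] by simp
    have "regular_at C f q" using q W1 W2 by blast
    moreover have "regular_at C (D_coeff C i c) q" if "c \<in> J" for c
    proof (cases c)
      case (Nonlocal w)
      then have "regular_at C (nl_coeff C i w) q" using q W2(4) that by blast
      moreover have "D_coeff C i c = nl_coeff C i w" using Nonlocal by auto
      ultimately show ?thesis by simp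
    next
      case (Jet \<alpha>)
      then have "D_coeff C i c = (\<lambda>p. p (Jet (add_mset i \<alpha>)))" by auto
      then show ?thesis using regular_at_coordinate[of "Jet (add_mset i \<alpha>)" C q] by (simp add: coords_def)
    next
      case (Indep j)
      then have "D_coeff C i c = (\<lambda>p. if j = i then 1 else 0)" by auto
      then show ?thesis by (simp add: regular_at_const)
    qed
    ultimately show "regular_at C (\<lambda>q. \<Sum>c\<in>J. D_coeff C i c q * pd c f q) q"
      using J(1) by (intro regular_at_sum regular_at_mult regular_at_pd)
  qed
  then show "\<exists>V. open V \<and> V \<subseteq> W \<and> V \<inter> manifold C \<noteq> {} \<and>
      (\<forall>p \<in> V \<inter> manifold C. regular_at C (total_D C i f) p)"
    using W1 W2 by (intro exI[of _ W2]) auto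
qed

subsection \<open>Total derivatives are tangent to the equation manifold\<close>

lemma total_D_eq_0_on_manifold:
  fixes p :: "'w point"
  assumes C: "open (cov_dom C)" and V: "open V" and p: "p \<in> V" "p \<in> manifold C"
    and f: "regular_at C f p" and zero: "\<And>q. q \<in> V \<Longrightarrow> q \<in> manifold C \<Longrightarrow> f q = 0"
  shows "total_D C i f p = 0"
proof -
  obtain W J where W: "open W" "p \<in> W" and J: "finite J" "J \<subseteq> coords C" "depends_on W J f"
    and hol: "separately_holomorphic W f" using f by (rule regular_atE)
  define P where "P = (\<lambda>\<alpha>. p (Jet \<alpha>))"
  define v where "v = (\<lambda>\<alpha>. P (add_mset i \<alpha>))"
  \<comment> \<open>The equation constrains jets only, so independent and nonlocal coordinates may
    follow straight lines. The jets do so too and are then brought back to the manifold by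
    \<open>solve\<close>; openness of \<open>cov_dom C\<close> keeps the curve in the covering near
    0.\<close>
  define \<delta> :: "complex \<Rightarrow> 'w point" where
    "\<delta> = (\<lambda>\<zeta> c. case c of Jet \<beta> \<Rightarrow> solve (\<lambda>\<alpha>. P \<alpha> + \<zeta> * v \<alpha>) \<beta> | _ \<Rightarrow> p c + \<zeta> * D_coeff C i c p)"
  have "p \<in> equation_manifold" using p(2) by (simp add: manifold_def)
  then have sol: "\<And>is. jeval (jders is eqn_jexp) P = 0" and S: "P {#S#} \<noteq> 0"
    by (auto simp: equation_manifold_iff P_def)
  have der: "((\<lambda>\<zeta>. \<delta> \<zeta> c) has_field_derivative D_coeff C i c p) (at 0)" for c
  proof (cases c)
    case (Jet \<beta>)
    then show ?thesis
      using has_field_derivative_solve[OF sol S, of i \<beta>] by (simp add: \<delta>_def v_def P_def)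
  qed (auto simp: \<delta>_def intro!: derivative_eq_intros)
  have \<delta>0: "\<delta> 0 = p"
  proof
    fix c
    show "\<delta> 0 c = p c"
      using solve_eq[OF sol S] by (cases c) (simp_all add: \<delta>_def P_def)
  qed
  \<comment> \<open>Only the finitely many coordinates on which \<open>f\<close> depends move along
    \<open>?q\<close>, as the chain rule requires. This curve may leave the manifold, but near 0
    \<open>f\<close> takes the same values on it as on \<open>\<delta>\<close>.\<close>
  let ?q = "\<lambda>\<zeta> c. if c \<in> J then \<delta> \<zeta> c else p c"
  have cont: "isCont (\<lambda>\<zeta>. \<delta> \<zeta> c) 0" for c
    using der by (rule DERIV_isCont)
  have q: "isCont (\<lambda>\<zeta>. ?q \<zeta> c) 0" for c
    using cont[of c] by (cases "c \<in> J") simp_all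
  have q0: "?q 0 = p" by (auto simp: \<delta>0)
  have "\<forall>\<^sub>F \<zeta> in nhds 0. ?q \<zeta> \<in> W"
    by (rule eventually_curve_in) (use q W q0 in auto)
  moreover have "\<forall>\<^sub>F \<zeta> in nhds 0. \<delta> \<zeta> \<in> W \<inter> V \<inter> cov_dom C"
    by (rule eventually_curve_in) (use cont W V C p \<delta>0 in \<open>auto simp: manifold_def\<close>)
  moreover have "\<forall>\<^sub>F \<zeta> in nhds 0. P {#S#} + \<zeta> * v {#S#} \<in> - {0}"
  proof -
    have "isCont (\<lambda>\<zeta>. P {#S#} + \<zeta> * v {#S#}) 0" by (intro continuous_intros)
    then have "\<forall>\<^sub>F \<zeta> in at 0. P {#S#} + \<zeta> * v {#S#} \<in> - {0}"
      unfolding isCont_def by (rule topological_tendstoD) (use S in \<open>auto simp: open_Compl\<close>)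
    then show ?thesis
      using S by (simp add: eventually_nhds_conv_at)
  qed
  ultimately have "\<forall>\<^sub>F \<zeta> in nhds 0. f (?q \<zeta>) = 0"
  proof eventually_elim
    case (elim \<zeta>)
    let ?P = "\<lambda>\<alpha>. P \<alpha> + \<zeta> * v \<alpha>"
    have "(\<lambda>\<alpha>. \<delta> \<zeta> (Jet \<alpha>)) = solve ?P" by (simp add: \<delta>_def)
    then have "\<delta> \<zeta> \<in> equation_manifold"
      using elim(3) solve_solves[of ?P] by (simp add: equation_manifold_iff \<delta>_def)
    then have "f (\<delta> \<zeta>) = 0" using elim(2) by (intro zero) (auto simp: manifold_def)
    moreover have "f (?q \<zeta>) = f (\<delta> \<zeta>)"
      by (rule depends_onD[OF J(3)]) (use elim(1,2) in auto)
    ultimately show ?case by simp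
  qed
  from DERIV_cong_ev[OF refl this refl]
  have "((\<lambda>\<zeta>. 0) has_field_derivative (\<Sum>c\<in>J. pd c f p * D_coeff C i c p)) (at (0::complex))"
    using has_field_derivative_along_curve[OF W hol der \<delta>0 J(1)] by (rule iffD1)
  then have "(\<Sum>c\<in>J. pd c f p * D_coeff C i c p) = 0"
    using DERIV_const by (rule DERIV_unique)
  then show ?thesis
    using regular_at_total_D_eq_sum[OF W J] by (simp add: mult.commute)
qed

lemma generically_total_D_eq_0:
  assumes C: "differential_covering C" and f: "generically C (regular_at C f)"
    and zero: "generically C (\<lambda>p. f p = 0)"
  shows "generically C (\<lambda>p. total_D C i f p = 0)"
proof -
  obtain V where V: "open V" "manifold C \<subseteq> closure (V \<inter> manifold C)"
    "\<And>p. p \<in> V \<inter> manifold C \<Longrightarrow> f p = 0 \<and> regular_at C f p"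
    using generically_conj[OF zero f] unfolding generically_def by blast
  have "open (cov_dom C)" using C by (simp add: differential_covering_def)
  then have "\<forall>p \<in> V \<inter> manifold C. total_D C i f p = 0"
    using V by (auto intro: total_D_eq_0_on_manifold)
  then show ?thesis using V(1,2) unfolding generically_def by blast
qed

section \<open>Passing to a larger covering\<close>

lemma manifold_mono: "covers C' C \<Longrightarrow> manifold C' \<subseteq> manifold C"
  by (auto simp: covers_def manifold_def)

text \<open>The manifold of \<open>C'\<close> is the part of that of \<open>C\<close> in the open
  set \<open>cov_dom C'\<close>, and intersecting with an open set preserves density of the nonzeros
  of the denominator.\<close>

lemma meromorphic_func_covers:
  assumes cov: "covers C' C" and f: "meromorphic_func C f"
  shows "meromorphic_func C' f"
  unfolding meromorphic_func_def
proof
  fix p assume p: "p \<in> manifold C'"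
  let ?D = "cov_dom C'"
  have D: "open ?D" "coords C \<subseteq> coords C'" "?D \<subseteq> cov_dom C"
    using cov by (auto simp: covers_def differential_covering_def coords_def)
  obtain V g h where V: "open V" "p \<in> V" "holomorphic_func C V g" "holomorphic_func C V h"
    "V \<inter> manifold C \<subseteq> closure {q \<in> V \<inter> manifold C. h q \<noteq> 0}"
    "\<forall>q \<in> V. h q \<noteq> 0 \<longrightarrow> f q = g q / h q"
    using f subsetD[OF manifold_mono[OF cov] p] by (rule meromorphic_funcE)
  have hol: "holomorphic_func C' (V \<inter> ?D) k" if "holomorphic_func C V k" for k
    using that D(2) unfolding holomorphic_func_iff
    by (meson Int_lower1 depends_on_mono order_refl order_trans separately_holomorphic_subset)
  have M: "manifold C' = ?D \<inter> manifold C" using D(3) by (auto simp: manifold_def)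
  have "V \<inter> ?D \<inter> manifold C' \<subseteq> ?D \<inter> closure {q \<in> V \<inter> manifold C. h q \<noteq> 0}"
    using V(5) M by blast
  also have "\<dots> \<subseteq> closure (?D \<inter> {q \<in> V \<inter> manifold C. h q \<noteq> 0})"
    using D(1) by (rule open_Int_closure_subset)
  also have "?D \<inter> {q \<in> V \<inter> manifold C. h q \<noteq> 0} = {q \<in> V \<inter> ?D \<inter> manifold C'. h q \<noteq> 0}"
    using M by blast
  finally show "\<exists>V g h. open V \<and> p \<in> V \<and> holomorphic_func C' V g \<and> holomorphic_func C' V h \<and>
      V \<inter> manifold C' \<subseteq> closure {q \<in> V \<inter> manifold C'. h q \<noteq> 0} \<and>
      (\<forall>q \<in> V. h q \<noteq> 0 \<longrightarrow> f q = g q / h q)"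
    using V hol D(1) p by (intro exI[of _ "V \<inter> ?D"] exI[of _ g] exI[of _ h]) (auto simp: manifold_def)
qed

subsection \<open>The recursion operator\<close>

lemma total_D_u: "total_D C i (u is) = u (i # is)"
proof -
  have u: "u js = (\<lambda>q. q (Jet (mset js)))" for js by (simp add: u_def fun_eq_iff)
  have "total_D C i (\<lambda>q. q (Jet (mset is))) = (\<lambda>q. q (Jet (mset (i # is))))"
    by (simp add: fun_eq_iff total_D_jet)
  then show ?thesis by (simp only: u)
qed

lemma regular_at_u: "regular_at C (u is) p"
  unfolding u_def by (rule regular_at_coordinate) (simp add: coords_def)

lemma u_mset_cong: "mset is = mset js \<Longrightarrow> u is p = u js p"
  by (simp add: u_def)

text \<open>The coefficients were found by eliminating the second derivatives of \<open>V\<close>, then \<open>V\<^sub>y\<close> and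
  \<open>V\<^sub>z\<close>; \<open>A\<close> and \<open>B\<close> are the two relations, \<open>F\<close> is the equation.\<close>

lemma elimination_identity:
  fixes us uz uy ust urz usx ury uxy uzt urs urzt ustx urrz ursx urxy urst urry :: complex
  assumes us: "us \<noteq> 0"
    and A: "us * Vz - uz * Vs + uz * Ur - us * Ux - (urz - usx) * U = 0"
    and B: "us * Vy - uy * Vs + uy * Ur - us * Ut + (ust - ury) * U = 0"
    and At: "us * Vtz + ust * Vz - (uz * Vts + uzt * Vs) + (uz * Utr + uzt * Ur) - (us * Utx + ust * Ux)
        - ((urz - usx) * Ut + (urzt - ustx) * U) = 0"
    and Ar: "us * Vrz + urs * Vz - (uz * Vrs + urz * Vs) + (uz * Urr + urz * Ur) - (us * Urx + urs * Ux)
        - ((urz - usx) * Ur + (urrz - ursx) * U) = 0"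
    and Bx: "us * Vxy + usx * Vy - (uy * Vxs + uxy * Vs) + (uy * Urx + uxy * Ur) - (us * Utx + usx * Ut)
        + ((ust - ury) * Ux + (ustx - urxy) * U) = 0"
    and Br: "us * Vry + urs * Vy - (uy * Vrs + ury * Vs) + (uy * Urr + ury * Ur) - (us * Utr + urs * Ut)
        + ((ust - ury) * Ur + (urst - urry) * U) = 0"
    and F: "us * uzt - uz * ust - us * uxy + uy * usx - uy * urz + uz * ury = 0"
    and Fr: "(us * urzt + urs * uzt) - (uz * urst + urz * ust) - (us * urxy + urs * uxy)
        + (uy * ursx + ury * usx) - (uy * urrz + ury * urz) + (uz * urry + urz * ury) = 0"
  shows "us * Vtz + uzt * Vs - uz * Vts - ust * Vz - us * Vxy - uxy * Vs + uy * Vxs + usx * Vy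
      - uy * Vrz - urz * Vy + uz * Vry + ury * Vz = 0" (is "?L = 0")
proof -
  \<comment> \<open>The factor \<open>us * us\<close> clears the denominators of the multipliers;
    those of \<open>A\<close> and \<open>B\<close> contain \<open>urs\<close> over the square of
    \<open>us\<close>.\<close>
  have "us * us * ?L =
      us * us * (us * Vtz + ust * Vz - (uz * Vts + uzt * Vs) + (uz * Utr + uzt * Ur) - (us * Utx + ust * Ux)
        - ((urz - usx) * Ut + (urzt - ustx) * U))
    - us * us * (us * Vxy + usx * Vy - (uy * Vxs + uxy * Vs) + (uy * Urx + uxy * Ur) - (us * Utx + usx * Ut)
        + ((ust - ury) * Ux + (ustx - urxy) * U))
    + us * uz * (us * Vry + urs * Vy - (uy * Vrs + ury * Vs) + (uy * Urr + ury * Ur) - (us * Utr + urs * Ut)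
        + ((ust - ury) * Ur + (urst - urry) * U))
    - us * uy * (us * Vrz + urs * Vz - (uz * Vrs + urz * Vs) + (uz * Urr + urz * Ur) - (us * Urx + urs * Ux)
        - ((urz - usx) * Ur + (urrz - ursx) * U))
    + (us * (2 * usx - urz) - uz * urs) * (us * Vy - uy * Vs + uy * Ur - us * Ut + (ust - ury) * U)
    + (us * (ury - 2 * ust) + uy * urs) * (us * Vz - uz * Vs + uz * Ur - us * Ux - (urz - usx) * U)
    + (2 * us * Vs - us * Ur - urs * U) *
        (us * uzt - uz * ust - us * uxy + uy * usx - uy * urz + uz * ury)
    + us * U * ((us * urzt + urs * uzt) - (uz * urst + urz * ust) - (us * urxy + urs * uxy)
        + (uy * ursx + ury * usx) - (uy * urrz + ury * urz) + (uz * urry + urz * ury))"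
    by algebra
  also have "\<dots> = 0"
    unfolding A B At Ar Bx Br F Fr by simp
  finally show ?thesis using us by simp
qed

theorem mainTheorem4:
  "recursion_operator (\<lambda>(C :: 'w covering) U V.
     generically C (\<lambda>p.
       total_D C Y V p = u [Y] p / u [S] p * total_D C S V p - u [Y] p / u [S] p * total_D C R U p
         + total_D C T U p - (u [S, T] p - u [R, Y] p) / u [S] p * U p) \<and>
     generically C (\<lambda>p.
       total_D C Z V p = u [Z] p / u [S] p * total_D C S V p - u [Z] p / u [S] p * total_D C R U p
         + total_D C X U p + (u [R, Z] p - u [S, X] p) / u [S] p * U p))"
  unfolding recursion_operator_def
proof (intro allI impI)
  fix C C' :: "'w covering" and U V
  assume cov: "covers C' C" and symU: "symmetry C U" and merV: "meromorphic_func C' V"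
  assume rel: "generically C' (\<lambda>p.
       total_D C' Y V p = u [Y] p / u [S] p * total_D C' S V p - u [Y] p / u [S] p * total_D C' R U p
         + total_D C' T U p - (u [S, T] p - u [R, Y] p) / u [S] p * U p) \<and>
     generically C' (\<lambda>p.
       total_D C' Z V p = u [Z] p / u [S] p * total_D C' S V p - u [Z] p / u [S] p * total_D C' R U p
         + total_D C' X U p + (u [R, Z] p - u [S, X] p) / u [S] p * U p)"
  have dc: "differential_covering C'" using cov by (simp add: covers_def)
  have merU: "meromorphic_func C' U"
    using cov symU by (auto simp: symmetry_def intro: meromorphic_func_covers)
  let ?D = "total_D C'"
  define A where "A = (\<lambda>p. u [S] p * ?D Z V p - u [Z] p * ?D S V p + u [Z] p * ?D R U p
      - u [S] p * ?D X U p - (u [R, Z] p - u [S, X] p) * U p)"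
  define B where "B = (\<lambda>p. u [S] p * ?D Y V p - u [Y] p * ?D S V p + u [Y] p * ?D R U p
      - u [S] p * ?D T U p + (u [S, T] p - u [R, Y] p) * U p)"
  have S: "u [S] p \<noteq> 0" if "p \<in> manifold C'" for p
    using that by (simp add: manifold_def equation_manifold_def)
  \<comment> \<open>Clearing denominators leaves \<open>A\<close> and \<open>B\<close> without
    division, so differentiating them needs only the Leibniz rule.\<close>
  have clear: "k * x - b * y + b * z - k * w - a * t = 0"
    if "x = b / k * y - b / k * z + w + a / k * t" "k \<noteq> 0" for a b k t w x y z :: complex
    unfolding that(1) using that(2) by (simp add: field_simps)
  have clear_minus: "k * x - b * y + b * z - k * w + a * t = 0"
    if "x = b / k * y - b / k * z + w - a / k * t" "k \<noteq> 0" for a b k t w x y z :: complex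
    unfolding that(1) using that(2) by (simp add: field_simps)
  have A0: "generically C' (\<lambda>p. A p = 0)"
    by (rule generically_mono[OF conjunct2[OF rel]]) (use clear S in \<open>simp add: A_def\<close>)
  have B0: "generically C' (\<lambda>p. B p = 0)"
    by (rule generically_mono[OF conjunct1[OF rel]]) (use clear_minus S in \<open>simp add: B_def\<close>)
  \<comment> \<open>These are the factors of \<open>A\<close> and \<open>B\<close> that are regular
    only generically; jets are regular everywhere.\<close>
  let ?reg = "\<lambda>p. regular_at C' U p \<and> regular_at C' V p \<and> regular_at C' (?D R U) p \<and>
      regular_at C' (?D T U) p \<and> regular_at C' (?D X U) p \<and> regular_at C' (?D S V) p \<and>
      regular_at C' (?D Y V) p \<and> regular_at C' (?D Z V) p"
  have reg: "generically C' ?reg"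
    by (intro generically_conj generically_regular_total_D[OF dc] generically_regular_meromorphic merU merV)
  have comm: "generically C' (\<lambda>p. ?D i (?D j f) p = ?D j (?D i f) p)" if "meromorphic_func C' f" for i j f
    using dc that by (simp add: differential_covering_def)
  have regA: "generically C' (regular_at C' A)"
    unfolding A_def by (rule generically_mono[OF reg])
      (intro regular_at_add regular_at_diff regular_at_mult regular_at_u; blast)
  have regB: "generically C' (regular_at C' B)"
    unfolding B_def by (rule generically_mono[OF reg])
      (intro regular_at_add regular_at_diff regular_at_mult regular_at_u; blast)
  note D0 = generically_total_D_eq_0[OF dc]
  \<comment> \<open>All facts are gathered on one dense open part. The commutators bring the mixed
    second derivatives of \<open>U\<close> and \<open>V\<close> to a common order.\<close>
  have "generically C' (\<lambda>p. A p = 0 \<and> B p = 0 \<and> ?D T A p = 0 \<and> ?D R A p = 0 \<and>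
      ?D X B p = 0 \<and> ?D R B p = 0 \<and> ?reg p \<and>
      ?D Z (?D T V) p = ?D T (?D Z V) p \<and> ?D S (?D T V) p = ?D T (?D S V) p \<and>
      ?D S (?D X V) p = ?D X (?D S V) p \<and> ?D R (?D T U) p = ?D T (?D R U) p \<and>
      ?D X (?D T U) p = ?D T (?D X U) p \<and> ?D X (?D R U) p = ?D R (?D X U) p)"
    by (intro generically_conj A0 B0 D0[OF regA A0] D0[OF regB B0] reg comm merU merV)
  then have "generically C' (\<lambda>p. linearization C' V p = 0)"
  proof (rule generically_mono, elim conjE)
    fix p
    assume p: "p \<in> manifold C'" and A: "A p = 0" and B: "B p = 0"
      and At: "?D T A p = 0" and Ar: "?D R A p = 0" and Bx: "?D X B p = 0" and Br: "?D R B p = 0"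
      and r: "regular_at C' U p" "regular_at C' V p" "regular_at C' (?D R U) p"
        "regular_at C' (?D T U) p" "regular_at C' (?D X U) p" "regular_at C' (?D S V) p"
        "regular_at C' (?D Y V) p" "regular_at C' (?D Z V) p"
      and c: "?D Z (?D T V) p = ?D T (?D Z V) p" "?D S (?D T V) p = ?D T (?D S V) p"
        "?D S (?D X V) p = ?D X (?D S V) p" "?D R (?D T U) p = ?D T (?D R U) p"
        "?D X (?D T U) p = ?D T (?D X U) p" "?D X (?D R U) p = ?D R (?D X U) p"
    have E: "p \<in> equation_manifold" using p by (simp add: manifold_def)
    note D_simps = total_D_add total_D_diff total_D_mult total_D_u regular_at_add regular_at_diff
      regular_at_mult regular_at_u r c
    have F: "eqn p = 0" and Fr: "?D R eqn p = 0"
      using jders_consequence[of "[]"] jders_consequence[of "[R]"] E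
      by (auto simp: equation_manifold_def eqn_eq_jfun total_D_jfun)
    have eqn: "eqn = (\<lambda>p. u [S] p * u [Z, T] p - u [Z] p * u [S, T] p - u [S] p * u [X, Y] p
         + u [Y] p * u [S, X] p - u [Y] p * u [R, Z] p + u [Z] p * u [R, Y] p)"
      by (simp add: fun_eq_iff eqn_def)
    \<comment> \<open>Indices of \<open>u\<close> are lists, so reordered indices of the same jet
      have to be identified explicitly.\<close>
    note perm = u_mset_cong[of "[T, S]" "[S, T]"] u_mset_cong[of "[T, Z]" "[Z, T]"]
      u_mset_cong[of "[X, S]" "[S, X]"] u_mset_cong[of "[T, R, Z]" "[R, Z, T]"]
      u_mset_cong[of "[T, S, X]" "[X, S, T]"] u_mset_cong[of "[X, R, Y]" "[R, X, Y]"]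
    \<comment> \<open>The linearization of \<open>V\<close>, with second derivatives in the order
      that differentiating \<open>A\<close> and \<open>B\<close> produces; the commutators
      \<open>c\<close> identify the two forms at the end.\<close>
    have "u [S] p * ?D T (?D Z V) p + u [Z, T] p * ?D S V p - u [Z] p * ?D T (?D S V) p
        - u [S, T] p * ?D Z V p - u [S] p * ?D X (?D Y V) p - u [X, Y] p * ?D S V p
        + u [Y] p * ?D X (?D S V) p + u [S, X] p * ?D Y V p - u [Y] p * ?D R (?D Z V) p
        - u [R, Z] p * ?D Y V p + u [Z] p * ?D R (?D Y V) p + u [R, Y] p * ?D Z V p = 0"
    proof (rule elimination_identity[OF S[OF p]])
      show "u [S] p * ?D Z V p - u [Z] p * ?D S V p + u [Z] p * ?D R U p
          - u [S] p * ?D X U p - (u [R, Z] p - u [S, X] p) * U p = 0"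
        using A by (simp add: A_def)
      show "u [S] p * ?D Y V p - u [Y] p * ?D S V p + u [Y] p * ?D R U p
          - u [S] p * ?D T U p + (u [S, T] p - u [R, Y] p) * U p = 0"
        using B by (simp add: B_def)
      show "u [S] p * ?D T (?D Z V) p + u [S, T] p * ?D Z V p
          - (u [Z] p * ?D T (?D S V) p + u [Z, T] p * ?D S V p)
          + (u [Z] p * ?D T (?D R U) p + u [Z, T] p * ?D R U p)
          - (u [S] p * ?D T (?D X U) p + u [S, T] p * ?D X U p)
          - ((u [R, Z] p - u [S, X] p) * ?D T U p + (u [R, Z, T] p - u [X, S, T] p) * U p) = 0"
        using At unfolding A_def by (simp add: D_simps perm)
      show "u [S] p * ?D R (?D Z V) p + u [R, S] p * ?D Z V p
          - (u [Z] p * ?D R (?D S V) p + u [R, Z] p * ?D S V p)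
          + (u [Z] p * ?D R (?D R U) p + u [R, Z] p * ?D R U p)
          - (u [S] p * ?D R (?D X U) p + u [R, S] p * ?D X U p)
          - ((u [R, Z] p - u [S, X] p) * ?D R U p + (u [R, R, Z] p - u [R, S, X] p) * U p) = 0"
        using Ar unfolding A_def by (simp add: D_simps perm)
      show "u [S] p * ?D X (?D Y V) p + u [S, X] p * ?D Y V p
          - (u [Y] p * ?D X (?D S V) p + u [X, Y] p * ?D S V p)
          + (u [Y] p * ?D R (?D X U) p + u [X, Y] p * ?D R U p)
          - (u [S] p * ?D T (?D X U) p + u [S, X] p * ?D T U p)
          + ((u [S, T] p - u [R, Y] p) * ?D X U p + (u [X, S, T] p - u [R, X, Y] p) * U p) = 0"
        using Bx unfolding B_def by (simp add: D_simps perm)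
      show "u [S] p * ?D R (?D Y V) p + u [R, S] p * ?D Y V p
          - (u [Y] p * ?D R (?D S V) p + u [R, Y] p * ?D S V p)
          + (u [Y] p * ?D R (?D R U) p + u [R, Y] p * ?D R U p)
          - (u [S] p * ?D T (?D R U) p + u [R, S] p * ?D T U p)
          + ((u [S, T] p - u [R, Y] p) * ?D R U p + (u [R, S, T] p - u [R, R, Y] p) * U p) = 0"
        using Br unfolding B_def by (simp add: D_simps perm)
      show "u [S] p * u [Z, T] p - u [Z] p * u [S, T] p - u [S] p * u [X, Y] p
          + u [Y] p * u [S, X] p - u [Y] p * u [R, Z] p + u [Z] p * u [R, Y] p = 0"
        using F by (simp add: eqn)
      show "(u [S] p * u [R, Z, T] p + u [R, S] p * u [Z, T] p)
          - (u [Z] p * u [R, S, T] p + u [R, Z] p * u [S, T] p)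
          - (u [S] p * u [R, X, Y] p + u [R, S] p * u [X, Y] p)
          + (u [Y] p * u [R, S, X] p + u [R, Y] p * u [S, X] p)
          - (u [Y] p * u [R, R, Z] p + u [R, Y] p * u [R, Z] p)
          + (u [Z] p * u [R, R, Y] p + u [R, Z] p * u [R, Y] p) = 0"
        using Fr unfolding eqn by (simp add: D_simps)
    qed
    then show "linearization C' V p = 0"
      by (simp add: linearization_def Let_def c)
  qed
  then show "symmetry C' V"
    using merV by (simp add: symmetry_def)
qed

end
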